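(* Let $\mu>0$, let $N\ge1$ be an integer, let $\alpha_1,\dots,\alpha_N\ge0$ with $\sum_{n=1}^N\alpha_n=1$, and let the pick times have the mixed Erlang (phase-type) distribution $G(x)=\sum_{n=1}^N\alpha_n\Big(1-e^{-\mu x}\sum_{j=0}^{n-1}\frac{(\mu x)^j}{j!}\Big)$, $x\ge0$. Assume that all $2N+2$ complex zeros $\widetilde r_1,\dots,\widetilde r_{2N+2}$ of $$\widetilde R(s)=s^2(\mu^2-s^2)^{N}+\sum_{n=1}^N\sum_{m=1}^N\alpha_n\alpha_m\mu^n\mu^m(\mu-s)^{N-n}(\mu+s)^{N-m}$$ are simple, and let $\widetilde c_i=\widetilde p(\widetilde r_i)/\widetilde R'(\widetilde r_i)$, where $\widetilde p$ is the polynomial defined in the context. Let $f$ be the density of the equilibrium waiting time $W$ on $[0,1]$ and $\phi(s)=\int_0^1e^{-sx}f(x)\,dx$. Then $$\phi(s)=\sum_{i=1}^{2N+2}\frac{\widetilde c_i}{s-\widetilde r_i}\big[1-e^{\widetilde r_i-s}\big],$$ and the density of the waiting time is the mixture of $2N+2$ exponentials $$f(x)=\sum_{i=1}^{2N+2}\widetilde c_i e^{\widetilde r_i x},\qquad 0\le x\le1.$$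
   Context: Model: $W_{n+1}=(R_{n+1}-P_n-W_n)^+$ for $n\ge 0$, with $P_0=W_0=0$ and $(x)^+=\max\{0,x\}$, where the pick times $(P_n)_{n\ge1}$ are i.i.d. with distribution function $G$, the rotation times $(R_n)_{n\ge1}$ are i.i.d. uniform on $[0,1)$, and the two sequences are independent. The Markov chain $(W_n)$ has a unique equilibrium distribution; $W$ denotes a random variable with that distribution, i.e. $W$ has the same distribution as $(R-P-W)^+$ with $R$ uniform on $[0,1)$, $P\sim G$, and $R,P,W$ independent. The law of $W$ consists of an atom $\pi_0=\mathbb{P}[W=0]$ at $0$ and a density $f$ on $[0,1]$, which satisfy $$f(x)=\pi_0G(1-x)+\int_0^{1-x}G(1-x-z)f(z)\,dz\quad(0\le x\le 1),\qquad \pi_0+\int_0^1f(x)\,dx=1.$$ Definition of the coefficients: with $\phi^{(\ell)}$ the $\ell$-th derivative of $\phi$, let $$\widetilde A(s)=\pi_0\sum_{n=1}^N\alpha_n\Big(\mu^n(\mu+s)^{N-n}+e^{-(\mu+s)}\sum_{j=0}^{n-1}\sum_{i=0}^{j}\frac{s\mu^j(\mu+s)^{N-j-1+i}}{i!}\Big)+\sum_{n=1}^N\alpha_n\Big(-e^{-s}(\mu+s)^{N}+e^{-(\mu+s)}\sum_{j=0}^{n-1}\sum_{i=0}^{j}\sum_{\ell=0}^{i}\binom{i}{\ell}\frac{s\mu^j(\mu+s)^{N-j-1+i}}{i!}\,\phi^{(\ell)}(-\mu)\Big),$$ where $\pi_0$ and the $\phi^{(\ell)}(-\mu)$ are regarded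 as already determined constants. The transform satisfies $\phi(s)\widetilde R(s)=-e^{-s}s(\mu+s)^{N}\widetilde A(-s)-\sum_{n=1}^N\alpha_n\mu^n(\mu-s)^{N-n}\widetilde A(s)$ for all $s$. Collecting the terms containing $e^{-s}$, the right-hand side of this identity is written uniquely as $\widetilde p(s)+e^{-s}\widetilde q(s)$ with polynomials $\widetilde p,\widetilde q$ in $s$; this defines $\widetilde p$. *)

theory Defs
  imports "HOL-Probability.Probability" "HOL-Computational_Algebra.Polynomial"
begin

definition mixed_erlang_cdf :: "nat \<Rightarrow> real \<Rightarrow> (nat \<Rightarrow> real) \<Rightarrow> real \<Rightarrow> real" where
  "mixed_erlang_cdf N \<mu> \<alpha> x =
     (if x < 0 then 0
      else \<Sum>n=1..N. \<alpha> n * (1 - exp (- (\<mu> * x)) * (\<Sum>j<n. (\<mu> * x) ^ j / fact j)))"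

text \<open>
  The random variable \<open>W\<close> has the equilibrium distribution of the chain
  \<open>W' = max 0 (R - P - W)\<close>, where \<open>R\<close> is uniform on \<open>[0,1)\<close>, \<open>P\<close> has distribution
  function \<open>G\<close>, and the three variables are independent (which, in the library, includes that
  they are measurable).
\<close>

definition equilibrium_waiting_time ::
    "'a measure \<Rightarrow> (real \<Rightarrow> real) \<Rightarrow> ('a \<Rightarrow> real) \<Rightarrow> ('a \<Rightarrow> real) \<Rightarrow> ('a \<Rightarrow> real) \<Rightarrow> bool" where
  "equilibrium_waiting_time M G R P W \<longleftrightarrow>
     prob_space M \<and>
     prob_space.indep_vars M (\<lambda>_. borel) (\<lambda>i. [R, P, W] ! i) {..<3} \<and>
     distr M borel R = uniform_measure lborel {0..<1} \<and>
     (\<forall>x. cdf (distr M borel P) x = G x) \<and>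
     distr M borel W = distr M borel (\<lambda>\<omega>. max 0 (R \<omega> - P \<omega> - W \<omega>))"

text \<open>
  The law of \<open>W\<close> is an atom of mass \<open>\<pi>\<^sub>0\<close> at \<open>0\<close> plus a density \<open>f\<close> on \<open>[0,1]\<close>.  The law
  determines \<open>f\<close> only up to null sets; the integral equation, required at every point of
  \<open>[0,1]\<close>, selects the version that is meant.  Taking \<open>A = UNIV\<close> gives the normalisation
  \<open>\<pi>\<^sub>0 + \<integral> f = 1\<close>.  The values of \<open>f\<close> outside \<open>[0,1]\<close> are irrelevant.
\<close>

definition waiting_time_density ::
    "real measure \<Rightarrow> (real \<Rightarrow> real) \<Rightarrow> real \<Rightarrow> (real \<Rightarrow> real) \<Rightarrow> bool" where
  "waiting_time_density L G \<pi>\<^sub>0 f \<longleftrightarrow>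
     set_integrable lborel {0..1} f \<and>
     (\<forall>A\<in>sets borel. measure L A = \<pi>\<^sub>0 * indicator A 0 + (LINT x:A \<inter> {0..1}|lborel. f x)) \<and>
     (\<forall>x\<in>{0..1}. f x = \<pi>\<^sub>0 * G (1 - x) + (LINT z:{0..1 - x}|lborel. G (1 - x - z) * f z))"

definition transform :: "(real \<Rightarrow> real) \<Rightarrow> complex \<Rightarrow> complex" where
  "transform f s = (LINT x:{0..1}|lborel. exp (- s * of_real x) * of_real (f x))"

definition R_tilde :: "nat \<Rightarrow> real \<Rightarrow> (nat \<Rightarrow> real) \<Rightarrow> complex poly" where
  "R_tilde N \<mu> \<alpha> =
     [:0, 1:] ^ 2 * ([:of_real \<mu>:] ^ 2 - [:0, 1:] ^ 2) ^ N +
     (\<Sum>n=1..N. \<Sum>m=1..N. smult (of_real (\<alpha> n * \<alpha> m * \<mu> ^ n * \<mu> ^ m))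
        ([:of_real \<mu>, -1:] ^ (N - n) * [:of_real \<mu>, 1:] ^ (N - m)))"

definition A_tilde ::
    "nat \<Rightarrow> real \<Rightarrow> (nat \<Rightarrow> real) \<Rightarrow> real \<Rightarrow> (complex \<Rightarrow> complex) \<Rightarrow> complex \<Rightarrow> complex" where
  "A_tilde N \<mu> \<alpha> \<pi>\<^sub>0 \<phi> s =
     of_real \<pi>\<^sub>0 * (\<Sum>n=1..N. of_real (\<alpha> n) *
        (of_real \<mu> ^ n * (of_real \<mu> + s) ^ (N - n) +
         exp (- (of_real \<mu> + s)) * (\<Sum>j<n. \<Sum>i\<le>j.
           s * of_real \<mu> ^ j * (of_real \<mu> + s) ^ (N - j - 1 + i) / fact i))) +
     (\<Sum>n=1..N. of_real (\<alpha> n) *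
        (- exp (- s) * (of_real \<mu> + s) ^ N +
         exp (- (of_real \<mu> + s)) * (\<Sum>j<n. \<Sum>i\<le>j. \<Sum>l\<le>i.
           of_nat (i choose l) *
           (s * of_real \<mu> ^ j * (of_real \<mu> + s) ^ (N - j - 1 + i) / fact i) *
           (deriv ^^ l) \<phi> (- of_real \<mu>))))"

definition transform_rhs ::
    "nat \<Rightarrow> real \<Rightarrow> (nat \<Rightarrow> real) \<Rightarrow> real \<Rightarrow> (complex \<Rightarrow> complex) \<Rightarrow> complex \<Rightarrow> complex" where
  "transform_rhs N \<mu> \<alpha> \<pi>\<^sub>0 \<phi> s =
     - exp (- s) * s * (of_real \<mu> + s) ^ N * A_tilde N \<mu> \<alpha> \<pi>\<^sub>0 \<phi> (- s)
     - (\<Sum>n=1..N. of_real (\<alpha> n) * of_real \<mu> ^ n * (of_real \<mu> - s) ^ (N - n))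
         * A_tilde N \<mu> \<alpha> \<pi>\<^sub>0 \<phi> s"

text \<open>
  The summand \<open>A_tilde (- s)\<close> contains \<open>exp s\<close>, which cancels against the prefactor
  \<open>exp (- s)\<close>; hence \<open>transform_rhs\<close> is of the form below.  The polynomials are unique because
  \<open>1\<close> and \<open>exp (- s)\<close> are linearly independent over the polynomials.
\<close>

definition p_tilde ::
    "nat \<Rightarrow> real \<Rightarrow> (nat \<Rightarrow> real) \<Rightarrow> real \<Rightarrow> (complex \<Rightarrow> complex) \<Rightarrow> complex poly" where
  "p_tilde N \<mu> \<alpha> \<pi>\<^sub>0 \<phi> =
     (THE p. \<exists>q. \<forall>s. transform_rhs N \<mu> \<alpha> \<pi>\<^sub>0 \<phi> s = poly p s + exp (- s) * poly q s)"

end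

theory Submission
  imports Defs
begin

text \<open>
  Substituting \<open>x \<mapsto> 1 - x\<close> in the integral equation for \<open>f\<close> gives a convolution equation
  \<open>f(1 - x) = \<pi>\<^sub>0 G(x) + (G * f)(x)\<close> on the unit interval.  Its Laplace transform over \<open>[0,1]\<close> expresses
  \<open>\<phi>(- s)\<close>, which comes from the left-hand side, through \<open>\<phi>(s)\<close>, which comes from the convolution, and
  through constants.  The truncated transforms of \<open>G\<close> that occur are elementary, since \<open>G\<close> is a
  constant plus a polynomial times an exponential (\<open>mixed_erlang_cdf_laplace\<close>); the result is
  \<open>transform_reflection_equation\<close>.  Combining this equation with its version at \<open>- s\<close> eliminates
  \<open>\<phi>(- s)\<close> and leaves \<open>\<phi> R = p + e\<^sup>-\<^sup>s q\<close> for all \<open>s\<close> (\<open>transform_equation\<close>,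
  \<open>p_tilde_decomposition\<close>).

  As \<open>\<phi>\<close> is finite everywhere, the right-hand side vanishes at each of the \<open>2 N + 2\<close> roots of \<open>R\<close>.
  This determines \<open>q\<close> at the roots from \<open>p\<close>, and since \<open>p\<close> and \<open>q\<close> have smaller degree than \<open>R\<close>,
  partial fractions give the stated formula for \<open>\<phi>\<close> off the roots (\<open>transform_partial_fractions\<close>).
  The formula is the transform of \<open>\<Sum>\<^sub>i c\<^sub>i exp (r\<^sub>i x)\<close>.  The transform is injective on continuous
  functions, even if finitely many of its values are ignored (\<open>finite_laplace_inject\<close>), and \<open>f\<close>
  is continuous (\<open>waiting_time_density_regular\<close>).  So \<open>f\<close> is this sum at every point of \<open>[0,1]\<close>, and
  the formula for \<open>\<phi>\<close> then holds at the roots as well.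
\<close>

section \<open>Partial fractions with simple poles\<close>

text \<open>
  Lagrange interpolation at the roots of \<open>R\<close>: the combination of the cofactors
  \<open>R / (X - z)\<close> with the stated coefficients agrees with \<open>P\<close> at every root, because the cofactor
  of \<open>z\<close> takes the value \<open>R'(z)\<close> at \<open>z\<close> and vanishes at the other roots.  Both sides have degree below
  the number of roots, so they are equal.
\<close>
lemma simple_roots_partial_fractions:
  fixes P R :: "'a::field_char_0 poly"
  assumes sqf: "rsquarefree R"
    and degP: "degree P < card {z. poly R z = 0}"
    and degR: "degree R \<le> card {z. poly R z = 0}"
    and s: "poly R s \<noteq> 0"
  shows "poly P s / poly R s
    = (\<Sum>z | poly R z = 0. poly P z / poly (pderiv R) z / (s - z))"
proof -
  define Z where "Z = {z. poly R z = 0}"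
  define cof where "cof z = R div [:-z, 1:]" for z
  define c where "c z = poly P z / poly (pderiv R) z" for z
  have R0: "R \<noteq> 0" using sqf by (simp add: rsquarefree_def)
  have finZ: "finite Z" unfolding Z_def using R0 by (rule poly_roots_finite)
  have Rcof: "R = [:-z, 1:] * cof z" if "z \<in> Z" for z
    using that dvd_mult_div_cancel[of "[:-z, 1:]" R] poly_eq_0_iff_dvd[of R z] unfolding Z_def cof_def by simp
  have cof0: "poly (cof z) w = 0" if "z \<in> Z" "w \<in> Z" "w \<noteq> z" for z w
  proof -
    have "poly R w = (w - z) * poly (cof z) w" by (subst Rcof[OF that(1)]) (simp add: algebra_simps)
    thus ?thesis using that by (simp add: Z_def)
  qed
  have cofz: "poly (cof z) z = poly (pderiv R) z" if "z \<in> Z" for z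
  proof -
    have "pderiv R = pderiv ([:-z, 1:] * cof z)" using Rcof[OF that] by simp
    also have "poly \<dots> z = poly (cof z) z" by (simp only: pderiv_mult poly_add poly_mult) (simp add: pderiv_pCons)
    finally show ?thesis by simp
  qed
  have dz: "poly (pderiv R) z \<noteq> 0" if "z \<in> Z" for z
    using sqf that unfolding rsquarefree_roots Z_def by blast
  define Q where "Q = (\<Sum>z\<in>Z. smult (c z) (cof z))"
  have degcof: "degree (cof z) < card Z" if "z \<in> Z" for z
  proof -
    have "cof z \<noteq> 0" using Rcof[OF that] R0 by auto
    hence "degree R = Suc (degree (cof z))"
      by (subst Rcof[OF that]) (subst degree_mult_eq, auto)
    thus ?thesis using degR by (simp add: Z_def)
  qed
  have "P = Q"
  proof (rule poly_eqI_degree[of Z])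
    fix w assume w: "w \<in> Z"
    have "poly Q w = (\<Sum>z\<in>Z. c z * poly (cof z) w)" by (simp add: Q_def poly_sum)
    also have "\<dots> = (\<Sum>z\<in>Z. if z = w then c w * poly (cof w) w else 0)"
      using cof0 w by (intro sum.cong) auto
    also have "\<dots> = poly P w" using w finZ cofz[OF w] dz[OF w] by (simp add: c_def)
    finally show "poly P w = poly Q w" ..
  next
    have "0 < card Z" using degP by (simp add: Z_def)
    hence "degree Q \<le> card Z - 1" unfolding Q_def
      by (intro degree_sum_le) (use finZ degcof in \<open>fastforce intro: order_trans[OF degree_smult_le]\<close>)+
    thus "degree Q < card Z" using \<open>0 < card Z\<close> by simp
  qed (use degP in \<open>simp add: Z_def\<close>)
  hence "poly P s = (\<Sum>z\<in>Z. c z * poly (cof z) s)" by (simp add: Q_def poly_sum)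
  hence "poly P s / poly R s = (\<Sum>z\<in>Z. c z * poly (cof z) s / poly R s)"
    by (simp add: sum_divide_distrib)
  also have "\<dots> = (\<Sum>z\<in>Z. c z / (s - z))"
  proof (rule sum.cong[OF refl])
    fix z assume z: "z \<in> Z"
    have "poly R s = (s - z) * poly (cof z) s" by (subst Rcof[OF z]) (simp add: algebra_simps)
    thus "c z * poly (cof z) s / poly R s = c z / (s - z)" using s by auto
  qed
  finally show ?thesis by (simp add: Z_def c_def)
qed

text \<open>
  The vanishing of the right-hand side at the roots \<open>z\<close> of \<open>R\<close> ties the values of \<open>Q\<close> to those of
  \<open>P\<close> by \<open>Q(z) = - e\<^sup>z P(z)\<close>.  So the partial fractions of \<open>P / R\<close> and of
  \<open>e\<^sup>-\<^sup>s Q / R\<close> have matching residues and combine to \<open>(1 - e\<^sup>z\<^sup>-\<^sup>s) / (s - z)\<close>.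
\<close>
lemma transform_partial_fractions:
  fixes R P Q :: "complex poly"
  assumes eq: "\<phi> s * poly R s = poly P s + exp (- s) * poly Q s"
    and at_roots: "\<And>z. poly R z = 0 \<Longrightarrow> poly P z + exp (- z) * poly Q z = 0"
    and sqf: "rsquarefree R" and degR: "degree R \<le> card {z. poly R z = 0}"
    and degP: "degree P < card {z. poly R z = 0}" and degQ: "degree Q < card {z. poly R z = 0}"
    and s: "poly R s \<noteq> 0"
  shows "\<phi> s = (\<Sum>z | poly R z = 0. poly P z / poly (pderiv R) z * ((1 - exp (z - s)) / (s - z)))"
proof -
  have Q: "poly Q z = - exp z * poly P z" if "poly R z = 0" for z
  proof -
    have "exp z * (poly P z + exp (- z) * poly Q z) = 0" using at_roots[OF that] by simp
    moreover have "exp z * exp (- z) = 1" by (simp add: exp_minus)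
    ultimately show ?thesis by (simp add: ring_distribs mult.assoc[symmetric] add_eq_0_iff2)
  qed
  have "\<phi> s = poly P s / poly R s + exp (- s) * (poly Q s / poly R s)"
    using eq s by (simp add: field_simps)
  also have "\<dots> = (\<Sum>z | poly R z = 0. poly P z / poly (pderiv R) z / (s - z)
      + exp (- s) * (poly Q z / poly (pderiv R) z / (s - z)))"
    by (simp only: simple_roots_partial_fractions[OF sqf degP degR s]
        simple_roots_partial_fractions[OF sqf degQ degR s] sum.distrib sum_distrib_left)
  also have "\<dots> = (\<Sum>z | poly R z = 0. poly P z / poly (pderiv R) z * ((1 - exp (z - s)) / (s - z)))"
  proof (intro sum.cong refl)
    fix z assume "z \<in> {z. poly R z = 0}"
    moreover have "exp (z - s) = exp (- s) * exp z" by (simp add: exp_add[symmetric])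
    ultimately show "poly P z / poly (pderiv R) z / (s - z) + exp (- s) * (poly Q z / poly (pderiv R) z / (s - z))
      = poly P z / poly (pderiv R) z * ((1 - exp (z - s)) / (s - z))"
      by (simp add: Q divide_inverse algebra_simps)
  qed
  finally show ?thesis .
qed

section \<open>The Laplace transform over the unit interval\<close>

text \<open>
  Compared with \<^const>\<open>transform\<close>, complex-valued functions are allowed, since the exponentials in the
  answer are complex, and the gauge integral is used, since everything of interest is continuous.
\<close>
definition finite_laplace :: "(real \<Rightarrow> complex) \<Rightarrow> complex \<Rightarrow> complex" where
  "finite_laplace h s = integral {0..1} (\<lambda>x. exp (- s * of_real x) * h x)"

lemma finite_laplace_moment_derivative:
  assumes "continuous_on {0..1} h"
  shows "(finite_laplace h has_field_derivative finite_laplace (\<lambda>x. - of_real x * h x) s) (at s)"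
proof -
  have "((\<lambda>s. integral (cbox 0 1) (\<lambda>x::real. exp (- s * of_real x) * h x)) has_field_derivative
      integral (cbox 0 1) (\<lambda>x. exp (- s * of_real x) * (- of_real x * h x))) (at s within UNIV)"
  proof (rule leibniz_rule_field_derivative)
    show "((\<lambda>s. exp (- s * of_real x) * h x) has_field_derivative
        exp (- s * of_real x) * (- of_real x * h x)) (at s within UNIV)" for s and x :: real
      by (auto intro!: derivative_eq_intros)
    show "(\<lambda>x::real. exp (- s * of_real x) * h x) integrable_on cbox 0 1" for s
      using assms by (auto intro!: integrable_continuous_real continuous_intros)
    have "continuous_on (UNIV \<times> {0..1}) (\<lambda>y::complex \<times> real. h (snd y))"
      by (rule continuous_on_compose2[OF assms]) (auto intro!: continuous_intros)
    thus "continuous_on (UNIV \<times> cbox 0 1)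
        (\<lambda>(s, x). exp (- s * of_real x) * (- complex_of_real x * h x))"
      by (auto simp: case_prod_unfold intro!: continuous_intros)
  qed auto
  thus ?thesis by (simp add: finite_laplace_def[abs_def])
qed

lemma higher_deriv_finite_laplace:
  assumes "continuous_on {0..1} h"
  shows "(deriv ^^ l) (finite_laplace h) = finite_laplace (\<lambda>x. (- of_real x) ^ l * h x)"
proof (induction l)
  case (Suc l)
  have "continuous_on {0..1} (\<lambda>x. (- of_real x) ^ l * h x)"
    using assms by (intro continuous_intros)
  from finite_laplace_moment_derivative[OF this]
  have "deriv (finite_laplace (\<lambda>x. (- of_real x) ^ l * h x))
      = finite_laplace (\<lambda>x. - of_real x * ((- of_real x) ^ l * h x))"
    by (intro ext DERIV_imp_deriv)
  thus ?case using Suc by (simp add: mult.assoc)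
qed simp

text \<open>
  This is where the constants \<open>\<phi>\<^sup>(\<^sup>l\<^sup>)(- \<mu>)\<close> come from: expanding \<open>(1 - z)\<^sup>i\<close> leaves moments
  of \<open>e\<^sup>a\<^sup>z h(z)\<close>, which are derivatives of the transform at \<open>- a\<close>.
\<close>
lemma finite_laplace_binomial:
  assumes h: "continuous_on {0..1} h"
  shows "integral {0..1} (\<lambda>z. exp (a * of_real z) * (1 - of_real z) ^ i * h z)
    = (\<Sum>l\<le>i. of_nat (i choose l) * (deriv ^^ l) (finite_laplace h) (- a))"
proof -
  have "exp (a * of_real z) * (1 - of_real z) ^ i * h z
      = (\<Sum>l\<le>i. of_nat (i choose l) * (exp (- (- a) * of_real z) * ((- of_real z) ^ l * h z)))" for z :: real
  proof -
    have "(1 - complex_of_real z) ^ i = (\<Sum>l\<le>i. of_nat (i choose l) * (- of_real z) ^ l)"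
      using binomial_ring[of "- complex_of_real z" 1 i] by simp
    thus ?thesis by (simp add: sum_distrib_left sum_distrib_right mult_ac)
  qed
  hence "integral {0..1} (\<lambda>z. exp (a * of_real z) * (1 - of_real z) ^ i * h z)
    = integral {0..1} (\<lambda>z. \<Sum>l\<le>i. of_nat (i choose l) * (exp (- (- a) * of_real z) * ((- of_real z) ^ l * h z)))"
    by presburger
  also have "\<dots> = (\<Sum>l\<le>i. integral {0..1} (\<lambda>z. of_nat (i choose l) * (exp (- (- a) * of_real z) * ((- of_real z) ^ l * h z))))"
    using h by (intro integral_sum integrable_continuous_real continuous_intros) auto
  also have "\<dots> = (\<Sum>l\<le>i. of_nat (i choose l) * (deriv ^^ l) (finite_laplace h) (- a))"
    by (simp only: higher_deriv_finite_laplace[OF h] finite_laplace_def integral_mult_right)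
  finally show ?thesis .
qed

lemma finite_laplace_reflect:
  "exp (- s) * finite_laplace h (- s) = finite_laplace (\<lambda>x. h (1 - x)) s"
proof -
  have "integral {0..1} (\<lambda>x. exp (s * of_real x) * h x)
      = integral {0..1} (\<lambda>x. exp (s * of_real (1 - x)) * h (1 - x))"
  proof -
    let ?g = "\<lambda>x. exp (s * of_real x) * h x"
    have "integral {0..1} ?g = integral {-1..0} (\<lambda>x. ?g (- x))"
      using Henstock_Kurzweil_Integration.integral_reflect_real[of 1 0 ?g] by simp
    also have "\<dots> = integral {0..1} (\<lambda>x. ?g (1 - x))"
      using integral_shift_Icc_real[of 0 1 "\<lambda>x. ?g (- x)" "-1"] by (simp add: o_def algebra_simps)
    finally show ?thesis .
  qed
  hence "exp (- s) * finite_laplace h (- s)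
      = integral {0..1} (\<lambda>x. exp (- s) * exp (s * of_real (1 - x)) * h (1 - x))"
    by (simp only: finite_laplace_def minus_minus mult.assoc integral_mult_right)
  moreover have "exp (- s) * exp (s * of_real (1 - x)) = exp (- s * of_real x)" for x
    by (simp add: exp_add[symmetric] algebra_simps)
  ultimately show ?thesis by (simp only: finite_laplace_def)
qed

lemma finite_laplace_diff:
  assumes "continuous_on {0..1} g" and "continuous_on {0..1} h"
  shows "finite_laplace (\<lambda>x. g x - h x) s = finite_laplace g s - finite_laplace h s"
  unfolding finite_laplace_def right_diff_distrib
  using assms by (intro integral_diff integrable_continuous_real continuous_intros)

lemma integral_exp_complex:
  "integral {0..1} (\<lambda>x. exp (a * complex_of_real x)) = (if a = 0 then 1 else (exp a - 1) / a)"
proof (cases "a = 0")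
  case False
  have "((\<lambda>x. exp (a * complex_of_real x)) has_integral exp (a * of_real 1) / a - exp (a * of_real 0) / a) {0..1}"
    by (rule fundamental_theorem_of_calculus)
      (use False in \<open>auto intro!: derivative_eq_intros has_vector_derivative_real_field\<close>)
  thus ?thesis using False by (simp add: integral_unique diff_divide_distrib)
qed simp

lemma finite_laplace_exp:
  "finite_laplace (\<lambda>x. exp (r * of_real x)) s = (if s = r then 1 else (1 - exp (r - s)) / (s - r))"
proof -
  have "exp (- s * of_real x) * exp (r * of_real x) = exp ((r - s) * complex_of_real x)" for x
    by (simp add: exp_add[symmetric] algebra_simps)
  hence "finite_laplace (\<lambda>x. exp (r * of_real x)) s = (if r - s = 0 then 1 else (exp (r - s) - 1) / (r - s))"
    unfolding finite_laplace_def by (simp only: integral_exp_complex)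
  also have "\<dots> = (if s = r then 1 else (1 - exp (r - s)) / (s - r))"
    by (auto simp: divide_simps algebra_simps)
  finally show ?thesis .
qed

lemma finite_laplace_exp_sum:
  "finite_laplace (\<lambda>x. \<Sum>i\<in>I. c i * exp (r i * of_real x)) s
    = (\<Sum>i\<in>I. c i * (if s = r i then 1 else (1 - exp (r i - s)) / (s - r i)))"
proof (cases "finite I")
  case True
  have "finite_laplace (\<lambda>x. \<Sum>i\<in>I. c i * exp (r i * of_real x)) s
      = integral {0..1} (\<lambda>x. \<Sum>i\<in>I. c i * (exp (- s * of_real x) * exp (r i * of_real x)))"
    unfolding finite_laplace_def by (simp add: sum_distrib_left mult_ac)
  also have "\<dots> = (\<Sum>i\<in>I. c i * finite_laplace (\<lambda>x. exp (r i * of_real x)) s)"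
    unfolding finite_laplace_def integral_mult_right[symmetric]
    by (intro integral_sum True integrable_continuous_real continuous_intros)
  finally show ?thesis by (simp only: finite_laplace_exp)
qed (simp add: finite_laplace_def)

text \<open>
  By Weierstrass, \<open>u\<close> is a uniform limit of polynomials \<open>g\<close>, to all of which it is orthogonal; hence
  \<open>\<integral> u\<^sup>2 = \<integral> (u - g) u\<close> is arbitrarily small.
\<close>
lemma continuous_zero_of_moments:
  fixes u :: "real \<Rightarrow> real"
  assumes u: "continuous_on {0..1} u"
    and mom: "\<And>l. integral {0..1} (\<lambda>x. x ^ l * u x) = 0"
    and x: "x \<in> {0..1}"
  shows "u x = 0"
proof -
  define I where "I = integral {0..1} (\<lambda>x. \<bar>u x\<bar>)"
  have I: "(\<lambda>x. \<bar>u x\<bar>) integrable_on {0..1}"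
    using u by (intro integrable_continuous_real continuous_intros)
  have I0: "0 \<le> I" unfolding I_def by (intro integral_nonneg I) auto
  have "integral {0..1} (\<lambda>x. (u x)\<^sup>2) \<le> e * I" if e: "e > 0" for e
  proof -
    obtain g where g: "real_polynomial_function g" "\<And>x. x \<in> {0..1} \<Longrightarrow> \<bar>u x - g x\<bar> < e"
      using Stone_Weierstrass_real_polynomial_function[OF compact_Icc u e] by blast
    then obtain a n where gs: "g = (\<lambda>x. \<Sum>i\<le>n. a i * x ^ i)"
      using real_polynomial_function_iff_sum by blast
    have int: "(\<lambda>x. a i * (x ^ i * u x)) integrable_on {0..1}" for i
      using u by (intro integrable_continuous_real continuous_intros)
    have "integral {0..1} (\<lambda>x. g x * u x) = integral {0..1} (\<lambda>x. \<Sum>i\<le>n. a i * (x ^ i * u x))"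
      by (simp add: gs sum_distrib_right mult.assoc)
    also have "\<dots> = (\<Sum>i\<le>n. integral {0..1} (\<lambda>x. a i * (x ^ i * u x)))"
      using int by (intro integral_sum) auto
    also have "\<dots> = 0" by (simp add: mom)
    finally have g0: "integral {0..1} (\<lambda>x. g x * u x) = 0" .
    have cg: "continuous_on {0..1} g" unfolding gs by (intro continuous_intros)
    have "integral {0..1} (\<lambda>x. (u x)\<^sup>2)
        = integral {0..1} (\<lambda>x. (u x)\<^sup>2) - integral {0..1} (\<lambda>x. g x * u x)"
      by (simp add: g0)
    also have "\<dots> = integral {0..1} (\<lambda>x. (u x)\<^sup>2 - g x * u x)"
      using u cg by (intro integral_diff[symmetric] integrable_continuous_real continuous_intros)
    also have "\<dots> \<le> integral {0..1} (\<lambda>x. e * \<bar>u x\<bar>)"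
    proof (rule integral_le)
      show "(\<lambda>x. (u x)\<^sup>2 - g x * u x) integrable_on {0..1}" "(\<lambda>x. e * \<bar>u x\<bar>) integrable_on {0..1}"
        using u cg by (auto intro!: integrable_continuous_real continuous_intros)
      fix x :: real assume "x \<in> {0..1}"
      have "(u x)\<^sup>2 - g x * u x = (u x - g x) * u x" by (simp add: power2_eq_square algebra_simps)
      also have "\<dots> \<le> \<bar>u x - g x\<bar> * \<bar>u x\<bar>" by (metis abs_ge_self abs_mult)
      also have "\<dots> \<le> e * \<bar>u x\<bar>"
        using g(2)[OF \<open>x \<in> {0..1}\<close>] by (intro mult_right_mono) auto
      finally show "(u x)\<^sup>2 - g x * u x \<le> e * \<bar>u x\<bar>" .
    qed
    finally show ?thesis by (simp add: I_def)
  qed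
  \<comment> \<open>\<open>I\<close> may be \<open>0\<close>, hence the \<open>I + 1\<close> in the denominator.\<close>
  from this[of "d / (I + 1)" for d] have "integral {0..1} (\<lambda>x. (u x)\<^sup>2) \<le> d" if "d > 0" for d
  proof -
    have "d / (I + 1) * I \<le> d" using that I0 by (simp add: field_simps)
    thus ?thesis using \<open>\<And>d. 0 < d / (I + 1) \<Longrightarrow> _\<close>[of d] that I0 by fastforce
  qed
  hence "integral {0..1} (\<lambda>x. (u x)\<^sup>2) \<le> 0" using dense_ge by blast
  moreover have "0 \<le> integral {0..1} (\<lambda>x. (u x)\<^sup>2)"
    using u by (intro integral_nonneg integrable_continuous_real continuous_intros) auto
  ultimately have "integral {0..1} (\<lambda>x. (u x)\<^sup>2) = 0" by simp
  moreover have "continuous_on {0..1} (\<lambda>x. (u x)\<^sup>2)" using u by (intro continuous_intros)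
  ultimately show ?thesis using integral_eq_0_iff[of 0 1 "\<lambda>x. (u x)\<^sup>2"] x by simp
qed

text \<open>
  Uniqueness of the transform.  A finite exceptional set is allowed because the partial fractions say
  nothing at the roots; it is removed by continuity.  An identically vanishing transform has
  vanishing derivatives at \<open>0\<close>, and these are the moments of \<open>h\<close> up to sign.
\<close>
lemma finite_laplace_inject:
  assumes h: "continuous_on {0..1} h"
    and fin: "finite Z" and zero: "\<And>s. s \<notin> Z \<Longrightarrow> finite_laplace h s = 0"
    and x: "x \<in> {0..1}"
  shows "h x = 0"
proof -
  have cont: "continuous_on UNIV (finite_laplace h)"
    using finite_laplace_moment_derivative[OF h]
    by (meson DERIV_continuous continuous_at_imp_continuous_on)
  have "finite_laplace h s = 0" for s
  proof -
    have "\<forall>\<^sub>F w in at s. w \<notin> Z"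
      using islimpt_finite[OF fin, of s] by (simp add: islimpt_iff_eventually)
    hence "\<forall>\<^sub>F w in at s. finite_laplace h w = 0"
      by eventually_elim (rule zero)
    hence "(finite_laplace h \<longlongrightarrow> 0) (at s)" by (rule tendsto_eventually)
    moreover have "(finite_laplace h \<longlongrightarrow> finite_laplace h s) (at s)"
      using cont by (simp add: continuous_on_def)
    ultimately show ?thesis using tendsto_unique[OF at_neq_bot] by blast
  qed
  hence z: "finite_laplace h = (\<lambda>_. 0)" by blast
  have "(deriv ^^ l) (\<lambda>_. 0) = (\<lambda>_. 0::complex)" for l by (induction l) auto
  hence "finite_laplace (\<lambda>x. (- of_real x) ^ l * h x) 0 = 0" for l
    unfolding higher_deriv_finite_laplace[OF h, of l, symmetric] z by simp
  hence "integral {0..1} (\<lambda>x. (- complex_of_real x) ^ l * h x) = 0" for l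
    by (simp add: finite_laplace_def)
  moreover have "integral {0..1} (\<lambda>x. (- complex_of_real x) ^ l * h x)
      = (-1) ^ l * integral {0..1} (\<lambda>x. of_real (x ^ l) * h x)" for l
  proof -
    have "(\<lambda>x. (- complex_of_real x) ^ l * h x) = (\<lambda>x. (-1) ^ l * (of_real (x ^ l) * h x))"
    proof
      show "(- complex_of_real x) ^ l * h x = (-1) ^ l * (of_real (x ^ l) * h x)" for x
        using power_mult_distrib[of "-1" "complex_of_real x" l] by simp
    qed
    thus ?thesis by (simp only: integral_mult_right)
  qed
  ultimately have m: "integral {0..1} (\<lambda>x. complex_of_real (x ^ l) * h x) = 0" for l by simp
  have int: "(\<lambda>x. complex_of_real (x ^ l) * h x) integrable_on {0..1}" for l
    using h by (intro integrable_continuous_real continuous_intros)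
  have "Re (h x) = 0"
  proof (rule continuous_zero_of_moments[OF _ _ x])
    show "integral {0..1} (\<lambda>x. x ^ l * Re (h x)) = 0" for l
      using integral_linear[OF int bounded_linear_Re, of l] m by (simp add: o_def)
  qed (use h in \<open>intro continuous_intros\<close>)
  moreover have "Im (h x) = 0"
  proof (rule continuous_zero_of_moments[OF _ _ x])
    show "integral {0..1} (\<lambda>x. x ^ l * Im (h x)) = 0" for l
      using integral_linear[OF int bounded_linear_Im, of l] m by (simp add: o_def)
  qed (use h in \<open>intro continuous_intros\<close>)
  ultimately show ?thesis by (simp add: complex_eq_iff)
qed

section \<open>Splitting the right-hand side into polynomials\<close>

text \<open>
  At \<open>s = 2 k \<pi> \<i>\<close> the exponential is \<open>1\<close> and at \<open>s = (2 k + 1) \<pi> \<i>\<close> it is \<open>- 1\<close>; so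
  \<open>P + Q\<close> and \<open>P - Q\<close> both have infinitely many roots.
\<close>
lemma poly_exp_independent:
  fixes P Q :: "complex poly"
  assumes "\<And>s. poly P s + exp (- s) * poly Q s = 0"
  shows "P = 0"
proof -
  have inf: "infinite (range (\<lambda>k::nat. \<i> * of_real (pi * (2 * real k + b))))" for b :: real
    by (rule range_inj_infinite) (auto simp: inj_def complex_eq_iff)
  have "poly (P + Q) s = 0" if "s \<in> range (\<lambda>k::nat. \<i> * of_real (pi * (2 * real k + 0)))" for s
  proof -
    from that obtain k :: nat where k: "s = \<i> * of_real (pi * (2 * real k + 0))" by blast
    have "exp (- s) = 1"
      unfolding k exp_eq_1 by (auto intro!: exI[of _ "- int k"])
    thus ?thesis using assms[of s] by simp
  qed
  hence "P + Q = 0" using inf[of 0] poly_roots_finite[of "P + Q"]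
    by (metis (mono_tags, lifting) finite_subset mem_Collect_eq subsetI)
  moreover have "poly (P - Q) s = 0" if "s \<in> range (\<lambda>k::nat. \<i> * of_real (pi * (2 * real k + 1)))" for s
  proof -
    from that obtain k :: nat where k: "s = \<i> * of_real (pi * (2 * real k + 1))" by blast
    have "exp (- s) = exp (- (\<i> * of_real (pi * (2 * real k)))) * exp (- (of_real pi * \<i>))"
      unfolding k by (simp add: exp_add[symmetric] algebra_simps)
    also have "exp (- (\<i> * of_real (pi * (2 * real k)))) = 1"
      unfolding exp_eq_1 by (auto intro!: exI[of _ "- int k"])
    also have "exp (- (of_real pi * \<i>)) = -1" by (simp add: exp_minus)
    finally show ?thesis using assms[of s] by simp
  qed
  hence "P - Q = 0" using inf[of 1] poly_roots_finite[of "P - Q"]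
    by (metis (mono_tags, lifting) finite_subset mem_Collect_eq subsetI)
  ultimately have "P + P = 0" by (simp add: eq_neg_iff_add_eq_0)
  hence "coeff P k + coeff P k = 0" for k by (metis coeff_0 coeff_add)
  thus ?thesis by (simp add: poly_eq_iff)
qed

text \<open>
  \<^const>\<open>A_tilde\<close> splits as \<open>A_poly + e\<^sup>-\<^sup>s A_exp_poly\<close>.
\<close>
definition A_poly :: "nat \<Rightarrow> real \<Rightarrow> (nat \<Rightarrow> real) \<Rightarrow> real \<Rightarrow> complex poly" where
  "A_poly N \<mu> \<alpha> \<pi>\<^sub>0 = (\<Sum>n=1..N. smult (of_real (\<pi>\<^sub>0 * \<alpha> n * \<mu> ^ n)) ([:of_real \<mu>, 1:] ^ (N - n)))"

definition A_exp_poly ::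
    "nat \<Rightarrow> real \<Rightarrow> (nat \<Rightarrow> real) \<Rightarrow> real \<Rightarrow> (complex \<Rightarrow> complex) \<Rightarrow> complex poly" where
  "A_exp_poly N \<mu> \<alpha> \<pi>\<^sub>0 \<phi> = (\<Sum>n=1..N. smult (of_real (\<alpha> n))
     ((\<Sum>j<n. \<Sum>i\<le>j. smult (exp (- of_real \<mu>) * of_real \<mu> ^ j / fact i *
          (of_real \<pi>\<^sub>0 + (\<Sum>l\<le>i. of_nat (i choose l) * (deriv ^^ l) \<phi> (- of_real \<mu>))))
        ([:0, 1:] * [:of_real \<mu>, 1:] ^ (N - j - 1 + i)))
      - [:of_real \<mu>, 1:] ^ N))"

text \<open>
  The factor which multiplies \<open>\<phi>(s)\<close> in the equation that relates it to \<open>\<phi>(- s)\<close>.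
\<close>
definition B_poly :: "nat \<Rightarrow> real \<Rightarrow> (nat \<Rightarrow> real) \<Rightarrow> complex poly" where
  "B_poly N \<mu> \<alpha> = (\<Sum>n=1..N. smult (of_real (\<alpha> n * \<mu> ^ n)) ([:of_real \<mu>, 1:] ^ (N - n)))"

lemma A_tilde_eq_polys:
  "A_tilde N \<mu> \<alpha> \<pi>\<^sub>0 \<phi> s = poly (A_poly N \<mu> \<alpha> \<pi>\<^sub>0) s + exp (- s) * poly (A_exp_poly N \<mu> \<alpha> \<pi>\<^sub>0 \<phi>) s"
proof -
  have e: "exp (- (of_real \<mu> + s)) = exp (- s) * exp (- of_real \<mu>)"
    by (simp add: exp_add[symmetric] algebra_simps)
  show ?thesis
    unfolding A_tilde_def A_poly_def A_exp_poly_def e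
    by (simp add: poly_sum sum_distrib_left sum_distrib_right sum.distrib sum_subtractf algebra_simps)
qed

lemma degree_linear_power_le: "degree ([:a, b:] ^ n) \<le> n"
  for a b :: "'a::{comm_semiring_1, semiring_no_zero_divisors}"
  using degree_power_le[of "[:a, b:]" n] degree_pCons_le[of a "[:b:]"] 
  by (metis One_nat_def degree_pCons_0 mult_le_mono1 nat_mult_1 order_trans)

lemma degree_A_poly: "degree (A_poly N \<mu> \<alpha> \<pi>\<^sub>0) \<le> N"
  unfolding A_poly_def
  by (intro degree_sum_le order_trans[OF degree_smult_le] order_trans[OF degree_linear_power_le]) auto

lemma degree_B_poly: "degree (B_poly N \<mu> \<alpha>) \<le> N - 1"
  unfolding B_poly_def
  by (intro degree_sum_le order_trans[OF degree_smult_le] order_trans[OF degree_linear_power_le]) auto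

lemma degree_A_exp_poly: "degree (A_exp_poly N \<mu> \<alpha> \<pi>\<^sub>0 \<phi>) \<le> N"
proof -
  have "degree ([:0, 1:] * [:complex_of_real \<mu>, 1:] ^ (N - j - 1 + i)) \<le> N"
    if "n \<in> {1..N}" "j < n" "i \<le> j" for n i j
    using degree_mult_le[of "[:0, 1:]" "[:complex_of_real \<mu>, 1:] ^ (N - j - 1 + i)"]
      degree_linear_power_le[of "complex_of_real \<mu>" 1 "N - j - 1 + i"] that by simp
  thus ?thesis unfolding A_exp_poly_def
    by (intro degree_sum_le order_trans[OF degree_smult_le] degree_diff_le degree_linear_power_le) auto
qed

text \<open>
  Reflecting \<open>s\<close> turns \<open>e\<^sup>-\<^sup>s\<close> into \<open>e\<^sup>s\<close>, which the prefactor \<open>e\<^sup>-\<^sup>s\<close> cancels; so in the reflected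
  summand the two halves of \<^const>\<open>A_tilde\<close> exchange their places.
\<close>
lemma transform_rhs_eq_polys:
  fixes N \<mu> \<alpha> \<pi>\<^sub>0 \<phi>
  defines "b \<equiv> B_poly N \<mu> \<alpha>" and "a \<equiv> A_poly N \<mu> \<alpha> \<pi>\<^sub>0" and "a' \<equiv> A_exp_poly N \<mu> \<alpha> \<pi>\<^sub>0 \<phi>"
  defines "X \<equiv> [:0, 1:] * [:complex_of_real \<mu>, 1:] ^ N"
  shows "transform_rhs N \<mu> \<alpha> \<pi>\<^sub>0 \<phi> s
    = poly (- X * pcompose a' [:0, -1:] - pcompose b [:0, -1:] * a) s
      + exp (- s) * poly (- X * pcompose a [:0, -1:] - pcompose b [:0, -1:] * a') s"
proof -
  have e: "exp (- s) * exp s = 1" by (simp add: exp_minus)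
  have b: "(\<Sum>n=1..N. of_real (\<alpha> n) * of_real \<mu> ^ n * (of_real \<mu> - s) ^ (N - n)) = poly b (- s)"
    by (simp add: b_def B_poly_def poly_sum)
  have "transform_rhs N \<mu> \<alpha> \<pi>\<^sub>0 \<phi> s = - exp (- s) * s * (of_real \<mu> + s) ^ N * (poly a (- s) + exp s * poly a' (- s))
     - poly b (- s) * (poly a s + exp (- s) * poly a' s)"
    unfolding transform_rhs_def b A_tilde_eq_polys by (simp add: a_def a'_def)
  also have "\<dots> = - exp (- s) * s * (of_real \<mu> + s) ^ N * poly a (- s)
     - (exp (- s) * exp s) * s * (of_real \<mu> + s) ^ N * poly a' (- s)
     - poly b (- s) * (poly a s + exp (- s) * poly a' s)"
    by (simp add: algebra_simps del: e)
  also have "\<dots> = poly (- X * pcompose a' [:0, -1:] - pcompose b [:0, -1:] * a) s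
      + exp (- s) * poly (- X * pcompose a [:0, -1:] - pcompose b [:0, -1:] * a') s"
    unfolding e by (simp add: X_def poly_pcompose algebra_simps)
  finally show ?thesis .
qed

text \<open>
  The definite description in \<^const>\<open>p_tilde\<close> denotes the expected polynomial by
  \<open>poly_exp_independent\<close>.  The degree bounds are what makes the rational functions
  \<open>p / R\<close> and \<open>q / R\<close> proper.
\<close>
lemma p_tilde_decomposition:
  assumes "N \<ge> 1"
  obtains q where "\<And>s. transform_rhs N \<mu> \<alpha> \<pi>\<^sub>0 \<phi> s
      = poly (p_tilde N \<mu> \<alpha> \<pi>\<^sub>0 \<phi>) s + exp (- s) * poly q s"
    and "degree (p_tilde N \<mu> \<alpha> \<pi>\<^sub>0 \<phi>) < 2 * N + 2" and "degree q < 2 * N + 2"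
proof -
  define b where "b = B_poly N \<mu> \<alpha>"
  define a where "a = A_poly N \<mu> \<alpha> \<pi>\<^sub>0"
  define a' where "a' = A_exp_poly N \<mu> \<alpha> \<pi>\<^sub>0 \<phi>"
  define X where "X = [:0, 1:] * [:complex_of_real \<mu>, 1:] ^ N"
  define p where "p = - X * pcompose a' [:0, -1:] - pcompose b [:0, -1:] * a"
  define q where "q = - X * pcompose a [:0, -1:] - pcompose b [:0, -1:] * a'"
  have eq: "transform_rhs N \<mu> \<alpha> \<pi>\<^sub>0 \<phi> s = poly p s + exp (- s) * poly q s" for s
    unfolding p_def q_def a_def a'_def b_def X_def by (rule transform_rhs_eq_polys)
  have "p_tilde N \<mu> \<alpha> \<pi>\<^sub>0 \<phi> = p" unfolding p_tilde_def
  proof (rule the_equality)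
    show "\<exists>q. \<forall>s. transform_rhs N \<mu> \<alpha> \<pi>\<^sub>0 \<phi> s = poly p s + exp (- s) * poly q s"
      using eq by blast
  next
    fix p' assume "\<exists>q. \<forall>s. transform_rhs N \<mu> \<alpha> \<pi>\<^sub>0 \<phi> s = poly p' s + exp (- s) * poly q s"
    then obtain q' where "\<And>s. transform_rhs N \<mu> \<alpha> \<pi>\<^sub>0 \<phi> s = poly p' s + exp (- s) * poly q' s"
      by blast
    hence "poly (p' - p) s + exp (- s) * poly (q' - q) s = 0" for s
      using eq[of s] by (simp add: algebra_simps)
    thus "p' = p" using poly_exp_independent by fastforce
  qed
  moreover have "degree X \<le> N + 1"
    unfolding X_def using degree_mult_le[of "[:0, 1:]" "[:complex_of_real \<mu>, 1:] ^ N"]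
      degree_linear_power_le[of "complex_of_real \<mu>" 1 N] by simp
  have comp: "degree (pcompose u [:0, -1:]) = degree u" for u :: "complex poly"
    by (simp add: degree_pcompose)
  have deg: "degree (- X * pcompose u [:0, -1:] - pcompose b [:0, -1:] * v) < 2 * N + 2"
    if "degree u \<le> N" "degree v \<le> N" for u v
  proof -
    have "degree (- X * pcompose u [:0, -1:]) \<le> (N + 1) + N"
      using degree_mult_le[of "- X" "pcompose u [:0, -1:]"] \<open>degree X \<le> N + 1\<close> that(1)
      by (simp add: comp)
    moreover have "degree (pcompose b [:0, -1:] * v) \<le> (N + 1) + N"
      using degree_mult_le[of "pcompose b [:0, -1:]" v] degree_B_poly[of N \<mu> \<alpha>] that(2)
      unfolding comp b_def[symmetric] by linarith
    ultimately have "degree (- X * pcompose u [:0, -1:] - pcompose b [:0, -1:] * v) \<le> (N + 1) + N"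
      by (rule degree_diff_le)
    thus ?thesis by simp
  qed
  ultimately show ?thesis
    using that[of q] eq deg[of a' a] deg[of a a'] degree_A_poly degree_A_exp_poly
    by (simp add: p_def q_def a_def a'_def)
qed

lemma R_tilde_eq:
  "poly (R_tilde N \<mu> \<alpha>) s
    = s\<^sup>2 * ((of_real \<mu>)\<^sup>2 - s\<^sup>2) ^ N + poly (B_poly N \<mu> \<alpha>) (- s) * poly (B_poly N \<mu> \<alpha>) s"
  unfolding R_tilde_def B_poly_def
  by (simp add: poly_sum sum_product power2_eq_square mult_ac)

lemma degree_R_tilde: "degree (R_tilde N \<mu> \<alpha>) \<le> 2 * N + 2"
proof -
  have "degree ([:of_real \<mu>:] ^ 2 - [:0, 1:] ^ 2 :: complex poly) \<le> 2"
    by (intro degree_diff_le) (auto simp: power2_eq_square)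
  hence "degree (([:of_real \<mu>:] ^ 2 - [:0, 1:] ^ 2 :: complex poly) ^ N) \<le> 2 * N"
    using degree_power_le[of "[:of_real \<mu>:] ^ 2 - [:0, 1:] ^ 2 :: complex poly" N]
    by (meson mult_le_mono1 order_trans)
  hence "degree ([:0, 1:] ^ 2 * ([:of_real \<mu>:] ^ 2 - [:0, 1:] ^ 2 :: complex poly) ^ N) \<le> 2 * N + 2"
    using degree_mult_le[of "[:0, 1:] ^ 2" "([:of_real \<mu>:] ^ 2 - [:0, 1:] ^ 2 :: complex poly) ^ N"]
      degree_linear_power_le[of "0::complex" 1 2] by linarith
  moreover have "degree ([:complex_of_real \<mu>, -1:] ^ (N - n) * [:of_real \<mu>, 1:] ^ (N - m)) \<le> 2 * N + 2" for n m
    using degree_mult_le[of "[:complex_of_real \<mu>, -1:] ^ (N - n)" "[:of_real \<mu>, 1:] ^ (N - m)"]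
      degree_linear_power_le[of "complex_of_real \<mu>" "-1" "N - n"]
      degree_linear_power_le[of "complex_of_real \<mu>" "1" "N - m"] by linarith
  ultimately show ?thesis unfolding R_tilde_def
    by (intro degree_add_le degree_sum_le order_trans[OF degree_smult_le]) auto
qed

section \<open>Regularity of the density\<close>

lemma mixed_erlang_cdf_nonpos: "x \<le> 0 \<Longrightarrow> mixed_erlang_cdf N \<mu> \<alpha> x = 0"
proof (cases "x = 0")
  case True
  have "(\<Sum>j<n. (0::real) ^ j / fact j) = 1" if "n \<ge> 1" for n
    using that by (subst sum.remove[of _ 0]) (auto intro!: sum.neutral)
  thus ?thesis using True by (auto simp: mixed_erlang_cdf_def intro!: sum.neutral)
qed (simp add: mixed_erlang_cdf_def)

lemma continuous_on_mixed_erlang_cdf: "continuous_on A (mixed_erlang_cdf N \<mu> \<alpha>)"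
proof -
  have "mixed_erlang_cdf N \<mu> \<alpha> x = (\<Sum>n=1..N. \<alpha> n * (1 - exp (- (\<mu> * max 0 x))
      * (\<Sum>j<n. (\<mu> * max 0 x) ^ j / fact j)))" for x
  proof (cases "x \<ge> 0")
    case False
    thus ?thesis using mixed_erlang_cdf_nonpos[of x N \<mu> \<alpha>] mixed_erlang_cdf_nonpos[of 0 N \<mu> \<alpha>]
      by (simp add: mixed_erlang_cdf_def max_def)
  qed (simp add: mixed_erlang_cdf_def max_def)
  thus ?thesis by (simp add: continuous_intros)
qed

text \<open>
  The vanishing of \<open>G\<close> on the negative half-line makes the upper limit of the convolution integral
  constant; this turns the triangle of integration into a square.
\<close>
lemma convolution_over_unit_interval:
  fixes G :: "real \<Rightarrow> real"
  assumes "\<And>x. x \<le> 0 \<Longrightarrow> G x = 0" and "y \<le> 1"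
  shows "(LINT z:{0..y}|lborel. G (y - z) * f z) = (LINT z:{0..1}|lborel. G (y - z) * f z)"
  unfolding set_lebesgue_integral_def
  by (intro Bochner_Integration.integral_cong) (use assms in \<open>auto simp: indicator_def\<close>)

lemma continuous_on_convolution:
  fixes G f :: "real \<Rightarrow> real"
  assumes f: "set_integrable lborel {0..1} f" and G: "continuous_on UNIV G"
  shows "continuous_on {0..1} (\<lambda>y. LINT z:{0..1}|lborel. G (y - z) * f z)"
proof (rule continuous_on_sequentiallyI)
  fix y and a :: real
  assume y: "\<forall>n. y n \<in> {0..1}" and a: "a \<in> {0..1}" and lim: "y \<longlonglongrightarrow> a"
  have "compact (G ` {-1..1})" using G by (intro compact_continuous_image continuous_on_subset[OF G]) auto
  then obtain C where C: "\<And>x. x \<in> {-1..1} \<Longrightarrow> \<bar>G x\<bar> \<le> C"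
    by (metis bounded_iff compact_imp_bounded imageI real_norm_def)
  define g where "g z = indicator {0..1} z *\<^sub>R f z" for z :: real
  have g: "integrable lborel g" using f by (simp add: g_def[abs_def] set_integrable_def)
  have [measurable]: "g \<in> borel_measurable borel" using borel_measurable_integrable[OF g] by simp
  have [measurable]: "G \<in> borel_measurable borel" using G by (rule borel_measurable_continuous_onI)
  have eq: "(LINT z:{0..1}|lborel. G (t - z) * f z) = (LINT z|lborel. G (t - z) * g z)" for t
    unfolding set_lebesgue_integral_def g_def by (intro Bochner_Integration.integral_cong) auto
  have "(\<lambda>n. LINT z|lborel. G (y n - z) * g z) \<longlonglongrightarrow> (LINT z|lborel. G (a - z) * g z)"
  proof (rule integral_dominated_convergence[where w = "\<lambda>z. C * \<bar>g z\<bar>"])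
    show "integrable lborel (\<lambda>z. C * \<bar>g z\<bar>)" using g by simp
    have "(\<lambda>n. G (y n - z) * g z) \<longlonglongrightarrow> G (a - z) * g z" for z
      using lim G
      by (intro tendsto_mult tendsto_const continuous_on_tendsto_compose[OF G] tendsto_diff) auto
    thus "AE z in lborel. (\<lambda>n. G (y n - z) * g z) \<longlonglongrightarrow> G (a - z) * g z" by simp
    have "norm (G (y n - z) * g z) \<le> C * \<bar>g z\<bar>" for n z
    proof (cases "z \<in> {0..1}")
      case True
      hence "y n - z \<in> {-1..1}" using y[rule_format, of n] by auto
      from C[OF this] show ?thesis by (simp add: abs_mult mult_right_mono)
    qed (simp add: g_def)
    thus "AE z in lborel. norm (G (y n - z) * g z) \<le> C * \<bar>g z\<bar>" for n by simp
  qed auto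
  thus "(\<lambda>n. LINT z:{0..1}|lborel. G (y n - z) * f z) \<longlonglongrightarrow> (LINT z:{0..1}|lborel. G (a - z) * f z)"
    by (simp add: eq)
qed

text \<open>
  The integral equation holds at every point and its right-hand side is continuous; hence so is \<open>f\<close>.
  This is what allows an equality of transforms to be turned into a pointwise equality.
\<close>
lemma waiting_time_density_regular:
  assumes G: "continuous_on UNIV G" and G0: "\<And>x. x \<le> 0 \<Longrightarrow> G x = 0"
    and dens: "waiting_time_density L G \<pi>\<^sub>0 f"
  shows waiting_time_density_continuous_on: "continuous_on {0..1} f"
    and waiting_time_density_reflected: "\<And>x. x \<in> {0..1} \<Longrightarrow>
      f (1 - x) = \<pi>\<^sub>0 * G x + integral {0..1} (\<lambda>z. G (x - z) * f z)"
proof -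
  have int: "set_integrable lborel {0..1} f"
    using dens by (simp add: waiting_time_density_def)
  have eq: "f x = \<pi>\<^sub>0 * G (1 - x) + (LINT z:{0..1}|lborel. G (1 - x - z) * f z)" if "x \<in> {0..1}" for x
    using dens that convolution_over_unit_interval[of G "1 - x" f] G0 by (simp add: waiting_time_density_def)
  have conv: "continuous_on {0..1} (\<lambda>x. LINT z:{0..1}|lborel. G (1 - x - z) * f z)"
    by (rule continuous_on_compose2[OF continuous_on_convolution[OF int G], of _ "\<lambda>x. 1 - x"])
      (auto intro!: continuous_intros)
  have "continuous_on {0..1} (\<lambda>x. \<pi>\<^sub>0 * G (1 - x) + (LINT z:{0..1}|lborel. G (1 - x - z) * f z))"
    by (intro continuous_on_add continuous_on_mult continuous_on_const conv
        continuous_on_compose2[OF G] continuous_on_diff continuous_on_id) auto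
  thus f: "continuous_on {0..1} f"
    by (rule continuous_on_eq) (use eq in simp)
  fix x :: real assume x: "x \<in> {0..1}"
  have "continuous_on {0..1} (\<lambda>z. G (x - z) * f z)"
    by (intro continuous_on_mult f continuous_on_compose2[OF G] continuous_on_diff continuous_on_const
        continuous_on_id) auto
  hence "(LINT z:{0..1}|lborel. G (x - z) * f z) = integral {0..1} (\<lambda>z. G (x - z) * f z)"
    by (intro set_borel_integral_eq_integral borel_integrable_atLeastAtMost')
  thus "f (1 - x) = \<pi>\<^sub>0 * G x + integral {0..1} (\<lambda>z. G (x - z) * f z)"
    using eq[of "1 - x"] x by simp
qed

lemma waiting_time_density_total_mass:
  assumes W: "prob_space L" "sets L = sets borel" and dens: "waiting_time_density L G \<pi>\<^sub>0 f"
    and f: "continuous_on {0..1} f"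
  shows "\<pi>\<^sub>0 + integral {0..1} f = 1"
proof -
  have "measure L UNIV = \<pi>\<^sub>0 + (LINT x:{0..1}|lborel. f x)"
    using dens unfolding waiting_time_density_def by (metis Int_UNIV_left indicator_UNIV mult.right_neutral sets.top space_borel)
  moreover have "space L = UNIV" using sets_eq_imp_space_eq[OF W(2)] by simp
  hence "measure L UNIV = 1" using prob_space.prob_space[OF W(1)] by simp
  moreover have "(LINT x:{0..1}|lborel. f x) = integral {0..1} f"
    using f by (intro set_borel_integral_eq_integral borel_integrable_atLeastAtMost')
  ultimately show ?thesis by simp
qed

lemma transform_eq_finite_laplace:
  assumes "continuous_on {0..1} f"
  shows "transform f = finite_laplace (\<lambda>x. of_real (f x))"
proof
  fix s
  have "continuous_on {0..1} (\<lambda>x. exp (- s * complex_of_real x) * complex_of_real (f x))"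
    using assms by (intro continuous_intros)
  thus "transform f s = finite_laplace (\<lambda>x. of_real (f x)) s"
    unfolding transform_def finite_laplace_def
    by (intro set_borel_integral_eq_integral borel_integrable_atLeastAtMost')
qed

section \<open>The truncated transform of the mixed Erlang distribution\<close>

text \<open>
  The double sum of \<^const>\<open>A_tilde\<close> with an additional argument \<open>t\<close>.  Multiplied by \<open>e\<^sup>-\<^sup>(\<^sup>\<mu>\<^sup>+\<^sup>s\<^sup>)\<^sup>t\<close>, it is
  a primitive of \<open>s (\<mu> + s)\<^sup>N e\<^sup>-\<^sup>s\<^sup>t (G\<^sub>n(t) - 1)\<close>, for the Erlang distribution function
  \<open>G\<^sub>n\<close> with \<open>n\<close> phases.
\<close>
definition erlang_remainder :: "nat \<Rightarrow> complex \<Rightarrow> nat \<Rightarrow> complex \<Rightarrow> complex \<Rightarrow> complex" where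
  "erlang_remainder N \<mu> n s t =
     (\<Sum>j<n. \<Sum>i\<le>j. s * \<mu> ^ j * (\<mu> + s) ^ (N - j - 1 + i) / fact i * t ^ i)"

text \<open>
  A telescoping geometric sum, since \<open>s = (\<mu> + s) - \<mu>\<close>.
\<close>
lemma erlang_remainder_0:
  assumes "n \<le> N"
  shows "erlang_remainder N \<mu> n s 0 = (\<mu> + s) ^ N - \<mu> ^ n * (\<mu> + s) ^ (N - n)"
proof -
  have "(\<Sum>i\<le>j. s * \<mu> ^ j * (\<mu> + s) ^ (N - j - 1 + i) / fact i * 0 ^ i)
      = s * \<mu> ^ j * (\<mu> + s) ^ (N - Suc j)" for j
    by (subst sum.remove[of _ 0]) (auto intro!: sum.neutral)
  hence "erlang_remainder N \<mu> n s 0 = (\<Sum>j<n. s * \<mu> ^ j * (\<mu> + s) ^ (N - Suc j))"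
    by (simp add: erlang_remainder_def)
  also have "\<dots> = (\<mu> + s) ^ N - \<mu> ^ n * (\<mu> + s) ^ (N - n)"
    using assms
  proof (induction n)
    case (Suc n)
    have "(\<mu> + s) ^ (N - n) = (\<mu> + s) * (\<mu> + s) ^ (N - Suc n)"
      using Suc.prems by (metis Suc_diff_Suc Suc_le_lessD power_Suc)
    thus ?case using Suc by (simp add: algebra_simps)
  qed simp
  finally show ?thesis .
qed

text \<open>
  Differentiating the partial sum removes its last term, and all other terms cancel against the
  derivative of the exponential factor.
\<close>
lemma exp_partial_sum_has_field_derivative:
  fixes a t :: complex
  shows "((\<lambda>t. exp (- (a * t)) * (\<Sum>i\<le>j. (a * t) ^ i / fact i)) has_field_derivative
    - a * exp (- (a * t)) * ((a * t) ^ j / fact j)) (at t)"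
proof (induction j)
  case 0
  show ?case by (auto intro!: derivative_eq_intros)
next
  case (Suc j)
  have "((\<lambda>t. (a * t) ^ Suc j) has_field_derivative of_nat (Suc j) * (a * t) ^ j * a) (at t)"
    by (rule DERIV_power_Suc[THEN DERIV_cong]) (auto intro!: derivative_eq_intros)
  from DERIV_cdivide[OF this, of "fact (Suc j)"]
  have "((\<lambda>t. (a * t) ^ Suc j / fact (Suc j)) has_field_derivative a * ((a * t) ^ j / fact j)) (at t)"
    by (rule DERIV_cong) (simp add: fact_Suc divide_simps del: of_nat_Suc)
  moreover have "((\<lambda>t. exp (- (a * t))) has_field_derivative - a * exp (- (a * t))) (at t)"
    by (auto intro!: derivative_eq_intros)
  ultimately have "((\<lambda>t. exp (- (a * t)) * ((a * t) ^ Suc j / fact (Suc j))) has_field_derivative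
      - a * exp (- (a * t)) * ((a * t) ^ Suc j / fact (Suc j))
      + a * ((a * t) ^ j / fact j) * exp (- (a * t))) (at t)"
    by (intro DERIV_mult)
  from DERIV_add[OF Suc this] show ?case by (simp add: algebra_simps)
qed

lemma erlang_remainder_has_field_derivative:
  assumes "n \<le> N"
  shows "((\<lambda>t. exp (- ((\<mu> + s) * t)) * erlang_remainder N \<mu> n s t) has_field_derivative
    - s * (\<mu> + s) ^ N * exp (- ((\<mu> + s) * t)) * (\<Sum>j<n. (\<mu> * t) ^ j / fact j)) (at t)"
proof -
  let ?a = "\<mu> + s"
  have "(\<lambda>t. exp (- (?a * t)) * erlang_remainder N \<mu> n s t) =
      (\<lambda>t. \<Sum>j<n. s * \<mu> ^ j * ?a ^ (N - j - 1) * (exp (- (?a * t)) * (\<Sum>i\<le>j. (?a * t) ^ i / fact i)))"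
    unfolding erlang_remainder_def sum_distrib_left
    by (intro ext sum.cong refl) (simp add: power_add power_mult_distrib)
  moreover have "(\<dots> has_field_derivative
      (\<Sum>j<n. s * \<mu> ^ j * ?a ^ (N - j - 1) * (- ?a * exp (- (?a * t)) * ((?a * t) ^ j / fact j)))) (at t)"
    by (intro DERIV_sum DERIV_cmult exp_partial_sum_has_field_derivative)
  moreover have "(\<Sum>j<n. s * \<mu> ^ j * ?a ^ (N - j - 1) * (- ?a * exp (- (?a * t)) * ((?a * t) ^ j / fact j)))
      = - s * ?a ^ N * exp (- (?a * t)) * (\<Sum>j<n. (\<mu> * t) ^ j / fact j)"
    unfolding sum_distrib_left
  proof (intro sum.cong refl)
    fix j assume "j \<in> {..<n}"
    hence "?a ^ N = ?a ^ ((N - j - 1) + 1 + j)" using assms by simp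
    hence "?a ^ N = ?a ^ (N - j - 1) * ?a * ?a ^ j" by (simp only: power_add power_one_right)
    thus "s * \<mu> ^ j * ?a ^ (N - j - 1) * (- ?a * exp (- (?a * t)) * ((?a * t) ^ j / fact j))
      = - s * ?a ^ N * exp (- (?a * t)) * ((\<mu> * t) ^ j / fact j)"
      unfolding power_mult_distrib by (simp add: divide_inverse algebra_simps)
  qed
  ultimately show ?thesis by metis
qed

text \<open>
  The fundamental theorem of calculus on \<open>{z..1}\<close>, the integrand being zero before \<open>z\<close>.  The factor
  \<open>s (\<mu> + s)\<^sup>N\<close> clears the denominators, so that the formula also covers \<open>s = 0\<close> and \<open>s = - \<mu>\<close>.
\<close>
lemma mixed_erlang_cdf_laplace:
  fixes N \<mu> \<alpha> and s :: complex
  assumes z: "z \<in> {0..1}"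
  defines "G \<equiv> mixed_erlang_cdf N \<mu> \<alpha>" and "m \<equiv> complex_of_real \<mu>"
  shows "s * (m + s) ^ N * integral {0..1} (\<lambda>x. exp (- s * of_real x) * of_real (G (x - z)))
    = (\<Sum>n=1..N. of_real (\<alpha> n) * (- ((m + s) ^ N * exp (- s)) + m ^ n * (m + s) ^ (N - n) * exp (- s * of_real z)
        + exp (- (m + s)) * (exp (m * of_real z) * erlang_remainder N m n s (1 - of_real z))))"
proof -
  \<comment> \<open>\<open>D n\<close> is \<open>s (m + s)\<^sup>N\<close> times the Laplace integrand of the \<open>n\<close>-phase Erlang law.\<close>
  define K where "K n t = - ((m + s) ^ N * exp (- s * t)) + exp (- ((m + s) * t)) * erlang_remainder N m n s t" for n t
  define D where "D n t = s * (m + s) ^ N * exp (- s * t) * (1 - exp (- (m * t)) * (\<Sum>j<n. (m * t) ^ j / fact j))" for n t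
  define F where "F x = exp (- s * of_real z) * (\<Sum>n=1..N. of_real (\<alpha> n) * K n (x - of_real z))" for x
  have K': "(K n has_field_derivative D n t) (at t)" if "n \<le> N" for n t
  proof -
    have "(K n has_field_derivative - ((m + s) ^ N * (- s * exp (- s * t))) + 
       (- s * (m + s) ^ N * exp (- ((m + s) * t)) * (\<Sum>j<n. (m * t) ^ j / fact j))) (at t)"
      unfolding K_def
      by (intro DERIV_add erlang_remainder_has_field_derivative that) (auto intro!: derivative_eq_intros)
    also have "exp (- ((m + s) * t)) = exp (- s * t) * exp (- (m * t))"
      by (simp add: exp_add[symmetric] algebra_simps)
    finally show ?thesis by (simp add: D_def algebra_simps)
  qed
  have F': "(F has_field_derivative exp (- s * of_real z) * (\<Sum>n=1..N. of_real (\<alpha> n) * D n (x - of_real z))) (at x)" for x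
  proof -
    have "((\<lambda>x. K n (x - of_real z)) has_field_derivative D n (x - of_real z) * 1) (at x)" if "n \<le> N" for n
      by (rule DERIV_chain2[OF K'[OF that]]) (auto intro!: derivative_eq_intros)
    thus ?thesis unfolding F_def by (intro DERIV_cmult DERIV_sum) auto
  qed
  have integrand: "exp (- s * of_real z) * (\<Sum>n=1..N. of_real (\<alpha> n) * D n (of_real x - of_real z))
      = s * (m + s) ^ N * (exp (- s * of_real x) * of_real (G (x - z)))" if "z \<le> x" for x
  proof -
    have "exp (- s * of_real z) * D n (of_real x - of_real z) = s * (m + s) ^ N * (exp (- s * of_real x)
       * of_real (1 - exp (- (\<mu> * (x - z))) * (\<Sum>j<n. (\<mu> * (x - z)) ^ j / fact j)))" for n
    proof -
      have "exp (- s * of_real x) = exp (- s * of_real z) * exp (- s * (of_real x - of_real z))"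
        by (simp add: exp_add[symmetric] algebra_simps)
      thus ?thesis by (simp add: D_def m_def exp_of_real[symmetric])
    qed
    moreover have "of_real (G (x - z)) = (\<Sum>n=1..N. of_real (\<alpha> n) *
        complex_of_real (1 - exp (- (\<mu> * (x - z))) * (\<Sum>j<n. (\<mu> * (x - z)) ^ j / fact j)))"
      using that by (simp add: G_def mixed_erlang_cdf_def)
    ultimately show ?thesis by (simp add: sum_distrib_left mult.left_commute)
  qed
  have "((\<lambda>x. exp (- s * of_real z) * (\<Sum>n=1..N. of_real (\<alpha> n) * D n (of_real x - of_real z)))
      has_integral F (of_real 1) - F (of_real z)) {z..1}"
    by (rule fundamental_theorem_of_calculus[of z 1 "\<lambda>x. F (of_real x)"])
      (use z in simp, rule has_vector_derivative_real_field[OF F'])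
  hence "((\<lambda>x. s * (m + s) ^ N * (exp (- s * of_real x) * of_real (G (x - z)))) has_integral
      F (of_real 1) - F (of_real z)) {z..1}"
    by (rule has_integral_eq[rotated]) (use integrand in auto)
  moreover have "((\<lambda>x. s * (m + s) ^ N * (exp (- s * of_real x) * of_real (G (x - z)))) has_integral 0) {0..z}"
    by (rule has_integral_is_0) (simp add: G_def mixed_erlang_cdf_nonpos)
  ultimately have "((\<lambda>x. s * (m + s) ^ N * (exp (- s * of_real x) * of_real (G (x - z)))) has_integral
      0 + (F (of_real 1) - F (of_real z))) {0..1}"
    using z by (intro has_integral_combine[of 0 z 1]) auto
  from integral_unique[OF this]
  have "s * (m + s) ^ N * integral {0..1} (\<lambda>x. exp (- s * of_real x) * of_real (G (x - z))) = F 1 - F (of_real z)"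
    by (simp only: integral_mult_right add_0 of_real_1)
  also have "\<dots> = exp (- s * of_real z) * (\<Sum>n=1..N. of_real (\<alpha> n) * (K n (1 - of_real z) - K n 0))"
    by (simp only: F_def right_diff_distrib sum_subtractf diff_self)
  also have "\<dots> = (\<Sum>n=1..N. of_real (\<alpha> n) * (exp (- s * of_real z) * (K n (1 - of_real z) - K n 0)))"
    unfolding sum_distrib_left by (intro sum.cong refl mult.left_commute)
  also have "\<dots> = (\<Sum>n=1..N. of_real (\<alpha> n) * (- ((m + s) ^ N * exp (- s)) + m ^ n * (m + s) ^ (N - n) * exp (- s * of_real z)
        + exp (- (m + s)) * (exp (m * of_real z) * erlang_remainder N m n s (1 - of_real z))))"
  proof (intro sum.cong refl arg_cong2[where f = times])
    fix n assume "n \<in> {1..N}"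
    hence "K n 0 = - (m ^ n * (m + s) ^ (N - n))" by (simp add: K_def erlang_remainder_0)
    moreover have "exp (- s * of_real z) * exp (- s * (1 - of_real z)) = exp (- s)"
      "exp (- s * of_real z) * exp (- ((m + s) * (1 - of_real z))) = exp (- (m + s)) * exp (m * of_real z)"
      by (simp_all add: exp_add[symmetric] algebra_simps)
    moreover have "e * (- (A * e1) + e2 * u + w) = - (A * (e * e1)) + w * e + (e * e2) * u"
      for e e1 e2 A u w :: complex
      by (simp add: algebra_simps)
    hence "exp (- s * of_real z) * (K n (1 - of_real z) + w)
      = - ((m + s) ^ N * (exp (- s * of_real z) * exp (- s * (1 - of_real z))))
        + w * exp (- s * of_real z) + (exp (- s * of_real z) * exp (- ((m + s) * (1 - of_real z))))
          * erlang_remainder N m n s (1 - of_real z)" for w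
      unfolding K_def .
    ultimately show "exp (- s * of_real z) * (K n (1 - of_real z) - K n 0) =
      - ((m + s) ^ N * exp (- s)) + m ^ n * (m + s) ^ (N - n) * exp (- s * of_real z)
        + exp (- (m + s)) * (exp (m * of_real z) * erlang_remainder N m n s (1 - of_real z))"
      by (simp only: diff_minus_eq_add mult.assoc)
  qed
  finally show ?thesis .
qed

lemma A_tilde_erlang_remainder:
  fixes \<mu> :: real
  defines "m \<equiv> complex_of_real \<mu>"
  shows "A_tilde N \<mu> \<alpha> \<pi>\<^sub>0 \<phi> s =
     of_real \<pi>\<^sub>0 * (\<Sum>n=1..N. of_real (\<alpha> n) *
        (m ^ n * (m + s) ^ (N - n) + exp (- (m + s)) * erlang_remainder N m n s 1)) +
     (\<Sum>n=1..N. of_real (\<alpha> n) *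
        (- exp (- s) * (m + s) ^ N + exp (- (m + s)) * (\<Sum>j<n. \<Sum>i\<le>j.
           s * m ^ j * (m + s) ^ (N - j - 1 + i) / fact i *
             (\<Sum>l\<le>i. of_nat (i choose l) * (deriv ^^ l) \<phi> (- m)))))"
proof -
  have inner: "(\<Sum>l\<le>i. of_nat (i choose l) * k * D l) = k * (\<Sum>l\<le>i. of_nat (i choose l) * D l)"
    for i and k :: complex and D by (simp add: sum_distrib_left mult_ac)
  show ?thesis
    unfolding A_tilde_def erlang_remainder_def m_def power_one mult_1_right inner ..
qed

section \<open>The functional equation of the transform\<close>

text \<open>
  The transform of the integral equation after the reflection \<open>x \<mapsto> 1 - x\<close>.  Interchanging the
  integrals turns the convolution into the truncated transform of \<open>G\<close>, evaluated by
  \<open>mixed_erlang_cdf_laplace\<close>.  Of its three summands, the first produces the mass of \<open>f\<close>, the second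
  \<open>\<phi>(s)\<close>, and the third the constants \<open>\<phi>\<^sup>(\<^sup>l\<^sup>)(- \<mu>)\<close>.  The atom at \<open>0\<close> contributes the same
  three terms at \<open>z = 0\<close>; its mass and that of \<open>f\<close> add up to \<open>1\<close>, which is why \<open>\<pi>\<^sub>0\<close> is absent from
  the term with \<open>- e\<^sup>-\<^sup>s (\<mu> + s)\<^sup>N\<close> in \<^const>\<open>A_tilde\<close>.
\<close>
lemma transform_reflection_equation:
  fixes N :: nat and \<mu> \<pi>\<^sub>0 :: real and \<alpha> :: "nat \<Rightarrow> real" and f :: "real \<Rightarrow> real" and s :: complex
  defines "G \<equiv> mixed_erlang_cdf N \<mu> \<alpha>" and "\<phi> \<equiv> finite_laplace (\<lambda>x. of_real (f x))"
  assumes f: "continuous_on {0..1} f"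
    and renewal: "\<And>x. x \<in> {0..1} \<Longrightarrow> f (1 - x) = \<pi>\<^sub>0 * G x + integral {0..1} (\<lambda>z. G (x - z) * f z)"
    and mass: "\<pi>\<^sub>0 + integral {0..1} f = 1"
  shows "s * (of_real \<mu> + s) ^ N * (exp (- s) * \<phi> (- s))
    = A_tilde N \<mu> \<alpha> \<pi>\<^sub>0 \<phi> s + poly (B_poly N \<mu> \<alpha>) s * \<phi> s"
proof -
  define m where "m = complex_of_real \<mu>"
  define \<Lambda> where "\<Lambda> = m + s"
  define F where "F x = complex_of_real (f x)" for x
  define H where "H n t = erlang_remainder N m n s t" for n t
  define J where "J z = integral {0..1} (\<lambda>x. exp (- s * of_real x) * of_real (G (x - z)))" for z :: real
  have F: "continuous_on {0..1} F" unfolding F_def using f by (intro continuous_intros)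
  have G: "continuous_on A G" for A unfolding G_def by (rule continuous_on_mixed_erlang_cdf)
  have Gc: "continuous_on A (\<lambda>y. G (u y))" if "continuous_on A u" for A :: "'x::topological_space set" and u
    by (rule continuous_on_compose2[OF G that]) (rule subset_UNIV)
  have \<phi>: "\<phi> = finite_laplace F" by (simp add: \<phi>_def F_def[abs_def])

  have GF: "(\<lambda>z. G (x - z) * f z) integrable_on {0..1}" for x
    by (intro integrable_continuous_real continuous_intros Gc f)
  have F1: "F (1 - x) = of_real \<pi>\<^sub>0 * of_real (G x) + integral {0..1} (\<lambda>z. of_real (G (x - z)) * F z)"
    if "x \<in> {0..1}" for x
    using integral_linear[OF GF bounded_linear_of_real[where 'a = complex], of x]
    by (simp add: F_def renewal[OF that] o_def)

  have c1: "continuous_on ({0..1} \<times> {0..1}) (\<lambda>(x, z). exp (- s * complex_of_real x) * (of_real (G (x - z)) * F z))"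
    unfolding case_prod_unfold
    by (intro continuous_intros Gc continuous_on_compose2[OF F]) auto
  have c2: "continuous_on {0..1} (\<lambda>z. exp (- s * complex_of_real x) * (of_real (G (x - z)) * F z))" for x
    by (intro continuous_intros Gc F)
  have c3: "continuous_on {0..1} (\<lambda>x. integral {0..1} (\<lambda>z. exp (- s * complex_of_real x) * (of_real (G (x - z)) * F z)))"
    using integral_continuous_on_param[of "{0..1}" 0 1 "\<lambda>x z. exp (- s * complex_of_real x) * (of_real (G (x - z)) * F z)"] c1
    by simp
  have "exp (- s) * \<phi> (- s) = finite_laplace (\<lambda>x. F (1 - x)) s"
    unfolding \<phi> by (rule finite_laplace_reflect)
  also have "\<dots> = integral {0..1} (\<lambda>x. of_real \<pi>\<^sub>0 * (exp (- s * of_real x) * of_real (G x))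
      + integral {0..1} (\<lambda>z. exp (- s * of_real x) * (of_real (G (x - z)) * F z)))"
    unfolding finite_laplace_def
    by (intro integral_cong) (simp only: F1 distrib_left integral_mult_right, simp only: mult.left_commute)
  also have "\<dots> = integral {0..1} (\<lambda>x. of_real \<pi>\<^sub>0 * (exp (- s * of_real x) * of_real (G x)))
      + integral {0..1} (\<lambda>x. integral {0..1} (\<lambda>z. exp (- s * of_real x) * (of_real (G (x - z)) * F z)))"
    by (intro integral_add integrable_continuous_real c3) (intro continuous_intros G)
  also have "integral {0..1} (\<lambda>x. of_real \<pi>\<^sub>0 * (exp (- s * of_real x) * of_real (G x))) = of_real \<pi>\<^sub>0 * J 0"
    by (simp only: integral_mult_right J_def diff_zero)
  also have "integral {0..1} (\<lambda>x. integral {0..1} (\<lambda>z. exp (- s * of_real x) * (of_real (G (x - z)) * F z)))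
      = integral {0..1} (\<lambda>z. integral {0..1} (\<lambda>x. exp (- s * of_real x) * (of_real (G (x - z)) * F z)))"
    using integral_swap_continuous[of 0 0 1 1 "\<lambda>x z. exp (- s * complex_of_real x) * (of_real (G (x - z)) * F z)"] c1
    by (simp add: cbox_Pair_eq)
  also have "\<dots> = integral {0..1} (\<lambda>z. J z * F z)"
    unfolding J_def by (simp only: mult.assoc[symmetric] integral_mult_left)
  finally have start: "exp (- s) * \<phi> (- s) = of_real \<pi>\<^sub>0 * J 0 + integral {0..1} (\<lambda>z. J z * F z)" .

  have J: "s * \<Lambda> ^ N * J z = (\<Sum>n=1..N. of_real (\<alpha> n) * (- (\<Lambda> ^ N * exp (- s))
      + m ^ n * \<Lambda> ^ (N - n) * exp (- s * of_real z) + exp (- \<Lambda>) * (exp (m * of_real z) * H n (1 - of_real z))))"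
    if "z \<in> {0..1}" for z
    unfolding \<Lambda>_def m_def H_def J_def G_def by (rule mixed_erlang_cdf_laplace[OF that])

  define E where "E n = (\<Sum>j<n. \<Sum>i\<le>j. s * m ^ j * \<Lambda> ^ (N - j - 1 + i) / fact i *
             (\<Sum>l\<le>i. of_nat (i choose l) * (deriv ^^ l) \<phi> (- m)))" for n
  have cH: "continuous_on {0..1} (\<lambda>z. H n (1 - complex_of_real z))" for n
    unfolding H_def erlang_remainder_def by (intro continuous_intros) auto
  have intH: "integral {0..1} (\<lambda>z. exp (m * of_real z) * H n (1 - of_real z) * F z) = E n" for n
  proof -
    let ?k = "\<lambda>i z. exp (m * complex_of_real z) * (1 - of_real z) ^ i * F z"
    have "(\<lambda>z. exp (m * of_real z) * H n (1 - of_real z) * F z)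
       = (\<lambda>z. \<Sum>j<n. \<Sum>i\<le>j. s * m ^ j * \<Lambda> ^ (N - j - 1 + i) / fact i * ?k i z)"
      by (simp add: H_def erlang_remainder_def \<Lambda>_def sum_distrib_left sum_distrib_right mult_ac)
    moreover have k: "?k i integrable_on {0..1}" for i
      by (intro integrable_continuous_real continuous_intros F)
    ultimately have "integral {0..1} (\<lambda>z. exp (m * of_real z) * H n (1 - of_real z) * F z)
       = (\<Sum>j<n. \<Sum>i\<le>j. s * m ^ j * \<Lambda> ^ (N - j - 1 + i) / fact i * integral {0..1} (?k i))"
      by (simp add: integral_sum integrable_sum integrable_on_mult_right del: times_divide_eq_left)
    thus ?thesis unfolding E_def \<phi> finite_laplace_binomial[OF F] .
  qed

  have "s * \<Lambda> ^ N * integral {0..1} (\<lambda>z. J z * F z) = integral {0..1} (\<lambda>z. s * \<Lambda> ^ N * J z * F z)"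
    by (simp only: mult.assoc integral_mult_right)
  also have "\<dots> = integral {0..1} (\<lambda>z. \<Sum>n=1..N. of_real (\<alpha> n) * (- (\<Lambda> ^ N * exp (- s)) * F z
      + m ^ n * \<Lambda> ^ (N - n) * (exp (- s * of_real z) * F z)
      + exp (- \<Lambda>) * (exp (m * of_real z) * H n (1 - of_real z) * F z)))"
    by (intro integral_cong) (simp only: J, simp only: sum_distrib_right ring_distribs mult.assoc)
  also have "\<dots> = (\<Sum>n=1..N. integral {0..1} (\<lambda>z. of_real (\<alpha> n) * (- (\<Lambda> ^ N * exp (- s)) * F z
      + m ^ n * \<Lambda> ^ (N - n) * (exp (- s * of_real z) * F z)
      + exp (- \<Lambda>) * (exp (m * of_real z) * H n (1 - of_real z) * F z))))"
    by (intro integral_sum integrable_continuous_real continuous_intros F cH) auto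
  also have "\<dots> = (\<Sum>n=1..N. of_real (\<alpha> n) * (- (\<Lambda> ^ N * exp (- s)) * integral {0..1} F
      + m ^ n * \<Lambda> ^ (N - n) * \<phi> s + exp (- \<Lambda>) * E n))"
  proof (intro sum.cong refl)
    fix n
    have i1: "(\<lambda>z. - (\<Lambda> ^ N * exp (- s)) * F z) integrable_on {0..1}"
      and i2: "(\<lambda>z. m ^ n * \<Lambda> ^ (N - n) * (exp (- s * of_real z) * F z)) integrable_on {0..1}"
      and i3: "(\<lambda>z. exp (- \<Lambda>) * (exp (m * of_real z) * H n (1 - of_real z) * F z)) integrable_on {0..1}"
      by (intro integrable_continuous_real continuous_intros F cH)+
    have "integral {0..1} (\<lambda>z. - (\<Lambda> ^ N * exp (- s)) * F z
        + m ^ n * \<Lambda> ^ (N - n) * (exp (- s * of_real z) * F z)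
        + exp (- \<Lambda>) * (exp (m * of_real z) * H n (1 - of_real z) * F z))
      = integral {0..1} (\<lambda>z. - (\<Lambda> ^ N * exp (- s)) * F z)
        + integral {0..1} (\<lambda>z. m ^ n * \<Lambda> ^ (N - n) * (exp (- s * of_real z) * F z))
        + integral {0..1} (\<lambda>z. exp (- \<Lambda>) * (exp (m * of_real z) * H n (1 - of_real z) * F z))"
      by (simp only: integral_add[OF integrable_add[OF i1 i2] i3] integral_add[OF i1 i2])
    thus "integral {0..1} (\<lambda>z. of_real (\<alpha> n) * (- (\<Lambda> ^ N * exp (- s)) * F z
        + m ^ n * \<Lambda> ^ (N - n) * (exp (- s * of_real z) * F z)
        + exp (- \<Lambda>) * (exp (m * of_real z) * H n (1 - of_real z) * F z)))
      = of_real (\<alpha> n) * (- (\<Lambda> ^ N * exp (- s)) * integral {0..1} F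
      + m ^ n * \<Lambda> ^ (N - n) * \<phi> s + exp (- \<Lambda>) * E n)"
      by (simp only: integral_mult_right intH \<phi> finite_laplace_def)
  qed
  finally have conv: "s * \<Lambda> ^ N * integral {0..1} (\<lambda>z. J z * F z)
    = (\<Sum>n=1..N. of_real (\<alpha> n) * (- (\<Lambda> ^ N * exp (- s)) * integral {0..1} F
      + m ^ n * \<Lambda> ^ (N - n) * \<phi> s + exp (- \<Lambda>) * E n))" .

  have "integral {0..1} F = of_real (integral {0..1} f)"
    using integral_linear[OF integrable_continuous_real[OF f] bounded_linear_of_real[where 'a = complex]]
    by (simp add: F_def[abs_def] o_def)
  also have "integral {0..1} f = 1 - \<pi>\<^sub>0" using mass by simp
  finally have IF: "integral {0..1} F = 1 - of_real \<pi>\<^sub>0" by simp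

  have "s * \<Lambda> ^ N * (exp (- s) * \<phi> (- s)) = of_real \<pi>\<^sub>0 * (s * \<Lambda> ^ N * J 0) + s * \<Lambda> ^ N * integral {0..1} (\<lambda>z. J z * F z)"
    by (simp add: start algebra_simps)
  also have "s * \<Lambda> ^ N * J 0 = (\<Sum>n=1..N. of_real (\<alpha> n) * (- (\<Lambda> ^ N * exp (- s))
      + m ^ n * \<Lambda> ^ (N - n) + exp (- \<Lambda>) * H n 1))"
    by (subst J) auto
  also have "of_real \<pi>\<^sub>0 * \<dots> + s * \<Lambda> ^ N * integral {0..1} (\<lambda>z. J z * F z)
      = A_tilde N \<mu> \<alpha> \<pi>\<^sub>0 \<phi> s + poly (B_poly N \<mu> \<alpha>) s * \<phi> s"
  proof -
    have B: "poly (B_poly N \<mu> \<alpha>) s = (\<Sum>n=1..N. of_real (\<alpha> n) * (m ^ n * \<Lambda> ^ (N - n)))"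
      by (simp add: B_poly_def poly_sum m_def \<Lambda>_def mult.assoc add.commute)
    have A: "A_tilde N \<mu> \<alpha> \<pi>\<^sub>0 \<phi> s = of_real \<pi>\<^sub>0 * (\<Sum>n=1..N. of_real (\<alpha> n) *
        (m ^ n * \<Lambda> ^ (N - n) + exp (- \<Lambda>) * H n 1)) + (\<Sum>n=1..N. of_real (\<alpha> n) * (- exp (- s) * \<Lambda> ^ N + exp (- \<Lambda>) * E n))"
      unfolding A_tilde_erlang_remainder H_def E_def \<Lambda>_def m_def ..
    show ?thesis unfolding conv A B IF sum_distrib_left sum_distrib_right sum.distrib[symmetric]
      by (intro sum.cong refl) (simp add: algebra_simps)
  qed
  finally show ?thesis by (simp add: \<Lambda>_def m_def)
qed

text \<open>
  The reflected equation at \<open>s\<close> and the one at \<open>- s\<close> are two linear equations for \<open>\<phi>(s)\<close> and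
  \<open>\<phi>(- s)\<close>; this is the elimination of \<open>\<phi>(- s)\<close>.
\<close>
lemma transform_equation:
  fixes N :: nat and \<mu> \<pi>\<^sub>0 :: real and \<alpha> :: "nat \<Rightarrow> real" and \<phi> :: "complex \<Rightarrow> complex"
  assumes reflected: "\<And>s. s * (of_real \<mu> + s) ^ N * (exp (- s) * \<phi> (- s))
    = A_tilde N \<mu> \<alpha> \<pi>\<^sub>0 \<phi> s + poly (B_poly N \<mu> \<alpha>) s * \<phi> s"
  shows "\<phi> s * poly (R_tilde N \<mu> \<alpha>) s = transform_rhs N \<mu> \<alpha> \<pi>\<^sub>0 \<phi> s"
proof -
  define B where "B = poly (B_poly N \<mu> \<alpha>)"
  define A where "A = A_tilde N \<mu> \<alpha> \<pi>\<^sub>0 \<phi>"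
  let ?m = "complex_of_real \<mu>"
  have 1: "B s * \<phi> s = s * (?m + s) ^ N * (exp (- s) * \<phi> (- s)) - A s"
    using reflected[of s] by (simp add: A_def B_def)
  have 2: "B (- s) * \<phi> (- s) = - s * (?m - s) ^ N * (exp s * \<phi> s) - A (- s)"
    using reflected[of "- s"] by (simp add: A_def B_def)
  have e: "exp (- s) * exp s = 1" by (simp add: exp_minus)
  have "(?m\<^sup>2 - s\<^sup>2) ^ N = (?m + s) ^ N * (?m - s) ^ N"
    by (simp add: power_mult_distrib[symmetric] power2_eq_square algebra_simps)
  hence "\<phi> s * poly (R_tilde N \<mu> \<alpha>) s = s\<^sup>2 * ((?m + s) ^ N * (?m - s) ^ N) * \<phi> s + B (- s) * (B s * \<phi> s)"
    by (simp add: R_tilde_eq B_def algebra_simps)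
  also have "\<dots> = s\<^sup>2 * ((?m + s) ^ N * (?m - s) ^ N) * \<phi> s
      + s * (?m + s) ^ N * exp (- s) * (B (- s) * \<phi> (- s)) - B (- s) * A s"
    unfolding 1 by (simp add: algebra_simps)
  also have "\<dots> = s\<^sup>2 * ((?m + s) ^ N * (?m - s) ^ N) * \<phi> s
      - s\<^sup>2 * ((?m + s) ^ N * (?m - s) ^ N) * (exp (- s) * exp s) * \<phi> s
      - exp (- s) * s * (?m + s) ^ N * A (- s) - B (- s) * A s"
    unfolding 2 by (simp add: algebra_simps power2_eq_square del: e)
  also have "\<dots> = transform_rhs N \<mu> \<alpha> \<pi>\<^sub>0 \<phi> s"
    unfolding e by (simp add: transform_rhs_def A_def B_def B_poly_def poly_sum)
  finally show ?thesis .
qed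

section \<open>The density as a mixture of exponentials\<close>

theorem mainTheorem7:
  fixes \<mu> \<pi>\<^sub>0 :: real and N :: nat and \<alpha> :: "nat \<Rightarrow> real"
    and M :: "'a measure" and R P W :: "'a \<Rightarrow> real"
    and f :: "real \<Rightarrow> real" and \<phi> :: "complex \<Rightarrow> complex"
    and r c :: "nat \<Rightarrow> complex"
  assumes "\<mu> > 0" and "N \<ge> 1"
    and "\<And>n. n \<in> {1..N} \<Longrightarrow> \<alpha> n \<ge> 0" and "(\<Sum>n=1..N. \<alpha> n) = 1"
    and "equilibrium_waiting_time M (mixed_erlang_cdf N \<mu> \<alpha>) R P W"
    and "\<pi>\<^sub>0 = measure M {\<omega> \<in> space M. W \<omega> = 0}"
    and "waiting_time_density (distr M borel W) (mixed_erlang_cdf N \<mu> \<alpha>) \<pi>\<^sub>0 f"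
    and "\<phi> = transform f"
    and "rsquarefree (R_tilde N \<mu> \<alpha>)"
    and "bij_betw r {1..2 * N + 2} {z. poly (R_tilde N \<mu> \<alpha>) z = 0}"
    and "\<And>i. c i = poly (p_tilde N \<mu> \<alpha> \<pi>\<^sub>0 \<phi>) (r i) / poly (pderiv (R_tilde N \<mu> \<alpha>)) (r i)"
  shows "(\<forall>s. \<phi> s = (\<Sum>i=1..2 * N + 2.
            if s = r i then c i else c i / (s - r i) * (1 - exp (r i - s)))) \<and>
         (\<forall>x\<in>{0..1}. complex_of_real (f x) = (\<Sum>i=1..2 * N + 2. c i * exp (r i * of_real x)))"
proof -
  define Z where "Z = {z. poly (R_tilde N \<mu> \<alpha>) z = 0}"
  define F where "F x = complex_of_real (f x)" for x
  define g where "g x = (\<Sum>i=1..2 * N + 2. c i * exp (r i * of_real x))" for x :: real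
  let ?G = "mixed_erlang_cdf N \<mu> \<alpha>"
  have cardZ: "card Z = 2 * N + 2"
    using bij_betw_same_card[OF assms(10)] by (simp add: Z_def)
  have finZ: "finite Z"
    unfolding Z_def using assms(9) by (intro poly_roots_finite) (simp add: rsquarefree_def)

  have prob: "prob_space M" and indep: "prob_space.indep_vars M (\<lambda>_. borel) (\<lambda>i. [R, P, W] ! i) {..<3}"
    using assms(5) by (auto simp: equilibrium_waiting_time_def)
  have "\<forall>i\<in>{..<3}. [R, P, W] ! i \<in> borel_measurable M"
    using indep unfolding prob_space.indep_vars_def2[OF prob] by simp
  from bspec[OF this, of 2] have "W \<in> borel_measurable M" by simp
  hence L: "prob_space (distr M borel W)" by (intro prob_space.prob_space_distr prob)

  have f: "continuous_on {0..1} f"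
    and renewal: "\<And>x. x \<in> {0..1} \<Longrightarrow> f (1 - x) = \<pi>\<^sub>0 * ?G x + integral {0..1} (\<lambda>z. ?G (x - z) * f z)"
    using waiting_time_density_regular[OF continuous_on_mixed_erlang_cdf mixed_erlang_cdf_nonpos assms(7)]
    by blast+
  have mass: "\<pi>\<^sub>0 + integral {0..1} f = 1"
    using waiting_time_density_total_mass[OF L _ assms(7) f] by simp
  have \<phi>: "\<phi> = finite_laplace F"
    unfolding assms(8) F_def by (rule transform_eq_finite_laplace[OF f])
  have Fc: "continuous_on {0..1} F" and gc: "continuous_on {0..1} g"
    unfolding F_def g_def by (intro continuous_intros f)+

  have key: "\<phi> s * poly (R_tilde N \<mu> \<alpha>) s = transform_rhs N \<mu> \<alpha> \<pi>\<^sub>0 \<phi> s" for s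
    by (rule transform_equation)
      (unfold \<phi> F_def, rule transform_reflection_equation[OF f renewal mass])
  obtain q where q: "\<And>s. transform_rhs N \<mu> \<alpha> \<pi>\<^sub>0 \<phi> s
      = poly (p_tilde N \<mu> \<alpha> \<pi>\<^sub>0 \<phi>) s + exp (- s) * poly q s"
    and deg: "degree (p_tilde N \<mu> \<alpha> \<pi>\<^sub>0 \<phi>) < 2 * N + 2" "degree q < 2 * N + 2"
    using p_tilde_decomposition[OF assms(2)] by blast

  have "\<phi> s = finite_laplace g s" if "s \<notin> Z" for s
  proof -
    have s: "poly (R_tilde N \<mu> \<alpha>) s \<noteq> 0" using that by (simp add: Z_def)
    have "\<phi> s = (\<Sum>z\<in>Z. poly (p_tilde N \<mu> \<alpha> \<pi>\<^sub>0 \<phi>) z / poly (pderiv (R_tilde N \<mu> \<alpha>)) z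
        * ((1 - exp (z - s)) / (s - z)))"
      unfolding Z_def
    proof (rule transform_partial_fractions[where Q = q])
      show "poly (p_tilde N \<mu> \<alpha> \<pi>\<^sub>0 \<phi>) z + exp (- z) * poly q z = 0"
        if "poly (R_tilde N \<mu> \<alpha>) z = 0" for z
        using key[of z] that by (simp add: q)
    qed (use s assms(9) deg cardZ key[of s] q degree_R_tilde[of N \<mu> \<alpha>] in \<open>simp_all add: Z_def\<close>)
    also have "\<dots> = (\<Sum>i=1..2 * N + 2. c i * ((1 - exp (r i - s)) / (s - r i)))"
      unfolding assms(11) by (rule sum.reindex_bij_betw[symmetric]) (use assms(10) in \<open>simp add: Z_def\<close>)
    also have "\<dots> = finite_laplace g s"
      unfolding g_def finite_laplace_exp_sum
    proof (intro sum.cong refl)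
      fix i assume "i \<in> {1..2 * N + 2}"
      hence "r i \<in> Z" using assms(10) by (auto simp: Z_def bij_betw_def)
      thus "c i * ((1 - exp (r i - s)) / (s - r i))
          = c i * (if s = r i then 1 else (1 - exp (r i - s)) / (s - r i))"
        using that by auto
    qed
    finally show ?thesis .
  qed
  hence "finite_laplace (\<lambda>x. F x - g x) s = 0" if "s \<notin> Z" for s
    using that by (simp add: finite_laplace_diff[OF Fc gc] \<phi>)
  hence "F x - g x = 0" if "x \<in> {0..1}" for x
    using finite_laplace_inject[OF continuous_on_diff[OF Fc gc] finZ _ that] by blast
  hence Fg: "F x = g x" if "x \<in> {0..1}" for x using that by simp
  have "\<phi> s = (\<Sum>i=1..2 * N + 2. if s = r i then c i else c i / (s - r i) * (1 - exp (r i - s)))" for s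
  proof -
    have "\<phi> s = finite_laplace g s"
      unfolding \<phi> finite_laplace_def by (intro integral_cong) (simp add: Fg)
    also have "\<dots> = (\<Sum>i=1..2 * N + 2. c i * (if s = r i then 1 else (1 - exp (r i - s)) / (s - r i)))"
      unfolding g_def by (rule finite_laplace_exp_sum)
    also have "\<dots> = (\<Sum>i=1..2 * N + 2. if s = r i then c i else c i / (s - r i) * (1 - exp (r i - s)))"
      by (intro sum.cong) auto
    finally show ?thesis .
  qed
  thus ?thesis using Fg by (simp add: F_def g_def)
qed

end
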